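(* Let $0<H<1$, fix a time horizon $T>0$, and for $\epsilon>0$ let $X^{\epsilon}$ be the kinetic fractional Brownian motion (defined in the context). For $N\in\mathbb{N}$ and $\delta=T/N$ (so $T=N\delta$), let $\hat{\sigma}^2_{\delta,\epsilon}=\frac1N(\Delta_\delta X^\epsilon)^{T}P^{-1}\Delta_\delta X^\epsilon$ be the estimator defined in the context. (i) For any fixed $\epsilon>0$, $$\lim_{\delta\to 0}\hat{\sigma}^{2}_{\delta,\epsilon}=0\quad\text{almost surely}$$ (the limit being taken along $\delta=T/N$, $N\to\infty$). (ii) If $\delta=\delta(\epsilon)=\epsilon^{\alpha}$ for some $\alpha>0$ with $\alpha>\max\{1,2(1-H)\}$, then $$\mathbb{E}\left[\hat{\sigma}^{2}_{\delta,\epsilon}\right]\longrightarrow 0\quad\text{as }\epsilon\to0^+$$ (with $\epsilon$ ranging over values for which $N=T/\delta$ is a positive integer).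
   Context: Fractional Brownian motion: $(B^H_t)_{t\in\mathbb{R}}$ is a (two-sided) fractional Brownian motion of Hurst index $H\in(0,1)$, i.e. a continuous centred Gaussian process with $\mathbb{E}[B^H_tB^H_s]=\frac12(|t|^{2H}+|s|^{2H}-|t-s|^{2H})$. Kinetic fractional Brownian motion: for fixed $\epsilon>0$ and constants $\sigma_1,\sigma_2,x_0\in\mathbb{R}$, $(X^\epsilon_t)_{t\ge0}$ is the solution of the system $$dX^\epsilon_t=\sigma_1\epsilon^{H-1}Y^\epsilon_t\,dt,\quad X^\epsilon_0=x_0,$$ $$dY^\epsilon_t=-\frac1\epsilon Y^\epsilon_t\,dt+\frac{\sigma_2}{\epsilon^H}\,dB^H_t,\quad Y^\epsilon_0=\epsilon^{-H}\sigma_2\int_{-\infty}^0 e^{s/\epsilon}\,dB^H_s,$$ so that $Y^\epsilon$ is the stationary fractional Ornstein-Uhlenbeck process $Y^\epsilon_t=\epsilon^{-H}\sigma_2\int_{-\infty}^t e^{-(t-s)/\epsilon}dB^H_s$. Increments and estimator: for $\delta=T/N$ and a process $Z$, $\Delta_\delta Z=(Z_{(i+1)\delta}-Z_{i\delta})_{i=0}^{N-1}\in\mathbb{R}^N$ (column vector). $P$ is the $N\times N$ covariance matrix of $\Delta_\delta B^H$, with entries $$P_{ij}=\tfrac12\delta^{2H}\left[(|i-j|+1)^{2H}+\big||i-j|-1\big|^{2H}-2|i-j|^{2H}\right].$$ The estimator is $\hat\sigma^2_{\delta,\epsilon}=\frac1N(\Delta_\delta X^\epsilon)^{T}P^{-1}\Delta_\delta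 X^\epsilon$, where the superscript $T$ on a vector denotes transpose. *)

theory Defs
  imports "HOL-Probability.Probability" "Jordan_Normal_Form.Gauss_Jordan_Elimination"
begin

text \<open>Normal distributions of variance zero (almost surely constant variables) count as Gaussian.\<close>

definition gaussian_rv :: "'a measure \<Rightarrow> ('a \<Rightarrow> real) \<Rightarrow> bool" where
  "gaussian_rv M Z \<longleftrightarrow> Z \<in> borel_measurable M \<and>
     ((\<exists>\<mu> \<sigma>. 0 < \<sigma> \<and> distributed M lborel Z (\<lambda>x. ennreal (normal_density \<mu> \<sigma> x))) \<or>
      (\<exists>\<mu>. AE \<omega> in M. Z \<omega> = \<mu>))"

definition gaussian_process :: "'a measure \<Rightarrow> (real \<Rightarrow> 'a \<Rightarrow> real) \<Rightarrow> bool" where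
  "gaussian_process M B \<longleftrightarrow>
     (\<forall>(S :: real set) (c :: real \<Rightarrow> real). finite S \<longrightarrow> gaussian_rv M (\<lambda>\<omega>. \<Sum>t\<in>S. c t * B t \<omega>))"

definition fractional_brownian_motion ::
  "'a measure \<Rightarrow> real \<Rightarrow> (real \<Rightarrow> 'a \<Rightarrow> real) \<Rightarrow> bool" where
  "fractional_brownian_motion M H B \<longleftrightarrow>
     gaussian_process M B \<and>
     (AE \<omega> in M. continuous_on UNIV (\<lambda>t. B t \<omega>)) \<and>
     (\<forall>t. (\<integral>\<omega>. B t \<omega> \<partial>M) = 0) \<and>
     (\<forall>s t. (\<integral>\<omega>. B t \<omega> * B s \<omega> \<partial>M) =
        (\<bar>t\<bar> powr (2 * H) + \<bar>s\<bar> powr (2 * H) - \<bar>t - s\<bar> powr (2 * H)) / 2)"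

text \<open>The integral of a smooth deterministic function against a continuous path is a
  Riemann--Stieltjes integral: the limit of tagged sums as the mesh tends to 0.\<close>

definition has_rs_integral ::
  "(real \<Rightarrow> real) \<Rightarrow> (real \<Rightarrow> real) \<Rightarrow> real \<Rightarrow> real \<Rightarrow> real \<Rightarrow> bool" where
  "has_rs_integral f g a b I \<longleftrightarrow>
     (\<forall>e>0. \<exists>d>0. \<forall>p. p tagged_division_of {a..b} \<and> (\<forall>(x, K)\<in>p. diameter K < d) \<longrightarrow>
        \<bar>(\<Sum>(x, K)\<in>p. f x * (g (Sup K) - g (Inf K))) - I\<bar> < e)"

definition has_improper_rs_integral ::
  "(real \<Rightarrow> real) \<Rightarrow> (real \<Rightarrow> real) \<Rightarrow> real \<Rightarrow> real \<Rightarrow> bool" where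
  "has_improper_rs_integral f g b I \<longleftrightarrow>
     (\<exists>J. (\<forall>a\<le>b. has_rs_integral f g a b (J a)) \<and> (J \<longlongrightarrow> I) at_bot)"

text \<open>The differential system is understood in integrated form, for almost every path and all
  \<open>t \<ge> 0\<close> simultaneously; its noise is additive, so the stochastic term is the increment
  \<open>B t - B 0\<close>.\<close>

definition kinetic_fbm ::
  "'a measure \<Rightarrow> real \<Rightarrow> (real \<Rightarrow> 'a \<Rightarrow> real) \<Rightarrow> real \<Rightarrow> real \<Rightarrow> real \<Rightarrow> real \<Rightarrow>
   (real \<Rightarrow> 'a \<Rightarrow> real) \<Rightarrow> (real \<Rightarrow> 'a \<Rightarrow> real) \<Rightarrow> bool" where
  "kinetic_fbm M H B \<sigma>\<^sub>1 \<sigma>\<^sub>2 x\<^sub>0 \<epsilon> X Y \<longleftrightarrow>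
     (\<forall>t\<ge>0. X t \<in> borel_measurable M \<and> Y t \<in> borel_measurable M) \<and>
     (AE \<omega> in M.
        continuous_on {0..} (\<lambda>t. Y t \<omega>) \<and>
        (\<exists>I. has_improper_rs_integral (\<lambda>s. exp (s / \<epsilon>)) (\<lambda>s. B s \<omega>) 0 I \<and>
             Y 0 \<omega> = \<epsilon> powr (- H) * \<sigma>\<^sub>2 * I) \<and>
        (\<forall>t\<ge>0. Y t \<omega> = Y 0 \<omega> - (1 / \<epsilon>) * integral {0..t} (\<lambda>s. Y s \<omega>)
                         + \<sigma>\<^sub>2 / \<epsilon> powr H * (B t \<omega> - B 0 \<omega>)) \<and>
        (\<forall>t\<ge>0. X t \<omega> = x\<^sub>0 + integral {0..t} (\<lambda>s. \<sigma>\<^sub>1 * \<epsilon> powr (H - 1) * Y s \<omega>)))"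

definition increments :: "real \<Rightarrow> nat \<Rightarrow> (real \<Rightarrow> real) \<Rightarrow> real Matrix.vec" where
  "increments \<delta> N z = Matrix.vec N (\<lambda>i. z ((real i + 1) * \<delta>) - z (real i * \<delta>))"

definition fgn_cov :: "real \<Rightarrow> real \<Rightarrow> nat \<Rightarrow> real Matrix.mat" where
  "fgn_cov H \<delta> N = Matrix.mat N N (\<lambda>(i, j).
     let k = \<bar>real i - real j\<bar> in
       1 / 2 * \<delta> powr (2 * H) *
         ((k + 1) powr (2 * H) + \<bar>k - 1\<bar> powr (2 * H) - 2 * k powr (2 * H)))"

definition sigma2_hat :: "real \<Rightarrow> real \<Rightarrow> nat \<Rightarrow> (real \<Rightarrow> real) \<Rightarrow> real" where
  "sigma2_hat H \<delta> N z =
     1 / real N * scalar_prod (increments \<delta> N z)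
       (the (mat_inverse (fgn_cov H \<delta> N)) *\<^sub>v increments \<delta> N z)"

end

theory Submission
  imports Defs "Jordan_Normal_Form.Determinant"
begin

text \<open>The position \<open>X\<close> integrates a continuous drift, so its increments over a step \<open>\<delta>\<close> have size
\<open>\<delta>\<close>. The matrix \<open>P\<close> is the covariance of the increments of a process whose increments have the
larger size \<open>\<delta> powr H\<close>. Normalising the former by the latter therefore gives something that vanishes
with \<open>\<delta>\<close>, and the crude estimate
  \<open>0 \<le> x \<bullet> (P\<^sup>-\<^sup>1 x) \<le> (x \<bullet> x) / c\<close>
for a lower bound \<open>c\<close> of the spectrum of \<open>P\<close> suffices to make this precise.

By self-similarity \<open>P\<close> is \<open>\<delta> powr (2 * H)\<close> times the Toeplitz matrix of the autocovariance of unit-step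
fractional Gaussian noise, and only the smallest eigenvalue of the latter has to be bounded below.
If \<open>2 * H \<le> 1\<close>, the entries off the diagonal are nonpositive, so the smallest row sum is a lower bound;
the row sums telescope and are at least \<open>2 * H * N powr (2 * H - 1)\<close>
(\<open>fgn_quadratic_form_bound_antipersistent\<close>). If \<open>2 * H > 1\<close>, the autocovariance is nonnegative, decreasing and
convex in the lag, with a strictly positive second difference at lag 1; by Polya's criterion it stays
positive semidefinite after this second difference is subtracted from its value at lag 0
(\<open>fgn_quadratic_form_bound_persistent\<close>), which gives a bound independent of \<open>N\<close>. In both cases
\<open>\<delta>\<^sup>2 / c\<close> is a constant multiple of \<open>\<delta> powr \<beta>\<close> with \<open>\<beta> = min 1 (2 * (1 - H))\<close> as long as \<open>N * \<delta> = T\<close>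
(\<open>sigma2_hat_rate\<close>).

For fixed \<open>\<epsilon>\<close> the paths of \<open>X\<close> are Lipschitz on \<open>[0, T]\<close>, and the estimator is \<open>O(\<delta> powr \<beta>)\<close> on each
such path. For the second claim the increments have to be bounded in mean square with an explicit
dependence on \<open>\<epsilon>\<close>: the stationary process \<open>Y\<close> has an \<open>L\<^sup>2\<close> norm bounded by a multiple of \<open>\<bar>\<sigma>\<^sub>2\<bar>\<close>
that does not depend on \<open>\<epsilon>\<close> (\<open>ou_l2_bound\<close>), so the increments of \<open>X\<close> are bounded by a multiple of
\<open>\<epsilon> powr (H - 1) * \<delta>\<close>, and the expectation of the estimator is \<open>O(\<epsilon> powr (\<alpha> * \<beta> - 2 * (1 - H)))\<close> when
\<open>\<delta> = \<epsilon> powr \<alpha>\<close>. Since \<open>max 1 (2 * (1 - H)) * \<beta> = 2 * (1 - H)\<close>, the assumption on \<open>\<alpha>\<close> says exactly that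
this exponent is positive.

All pathwise integrals are treated alike: they are almost sure limits of sums over uniform grids,
Minkowski's inequality bounds the \<open>L\<^sup>2\<close> norm of each sum, and Fatou's lemma passes to the limit.\<close>

section \<open>Iterated differences of powers\<close>

primrec power_diff :: "nat \<Rightarrow> real \<Rightarrow> real \<Rightarrow> real" where
  "power_diff 0 q x = x powr q"
| "power_diff (Suc n) q x = power_diff n q (x + 1) - power_diff n q x"

lemma power_diff_has_derivative:
  assumes "0 < x"
  shows "(power_diff n q has_real_derivative q * power_diff n (q - 1) x) (at x)"
  using assms
proof (induction n arbitrary: x)
  case 0
  then show ?case by (auto intro!: derivative_eq_intros)
next
  case (Suc n)
  have 1: "((\<lambda>x. power_diff n q (x + 1)) has_real_derivative q * power_diff n (q - 1) (x + 1)) (at x)"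
    using DERIV_shift[of "power_diff n q" _ x 1] Suc.IH[of "x + 1"] Suc.prems by simp
  from DERIV_diff[OF 1 Suc.IH[OF Suc.prems]] show ?case
    by (simp add: algebra_simps fun_eq_iff)
qed

lemma continuous_on_power_diff:
  assumes "0 < q"
  shows "continuous_on {0..} (power_diff n q)"
proof (induction n)
  case 0
  have "power_diff 0 q = (\<lambda>x. x powr q)" by (simp add: fun_eq_iff)
  then show ?case
    using continuous_on_powr'[OF continuous_on_id continuous_on_const, of "{0..}" q] assms by simp
next
  case (Suc n)
  have "continuous_on {0..} (\<lambda>x. power_diff n q (x + 1))"
    by (rule continuous_on_compose2[OF Suc]) (auto intro!: continuous_intros)
  moreover have "power_diff (Suc n) q = (\<lambda>x. power_diff n q (x + 1) - power_diff n q x)"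
    by (simp add: fun_eq_iff)
  ultimately show ?case using Suc by (auto intro!: continuous_intros)
qed

text \<open>The sign of every iterated difference of a power is that of the falling factorial
\<open>q (q - 1) \<dots> (q - n + 1)\<close>: differencing commutes with differentiation, so one application of the
mean value theorem trades the outermost difference for a factor \<open>q\<close> and the exponent \<open>q - 1\<close>.
The point \<open>x = 0\<close> is included because the difference is still continuous there for \<open>q > 0\<close>; the
mean value theorem then moves to an interior point, where negative exponents are harmless.\<close>
lemma power_diff_mean_value:
  assumes "0 \<le> x" and "0 < q \<or> 0 < x"
  shows "\<exists>\<xi>. x \<le> \<xi> \<and> \<xi> \<le> x + real n \<and> (0 < n \<or> 0 < x \<longrightarrow> 0 < \<xi>) \<and>
    power_diff n q x = (\<Prod>i<n. q - real i) * \<xi> powr (q - real n)"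
  using assms
proof (induction n arbitrary: q x)
  case 0
  then show ?case by auto
next
  case (Suc n)
  have cont: "continuous_on {x..x + 1} (power_diff n q)"
  proof (cases "0 < q")
    case True
    show ?thesis
      by (rule continuous_on_subset[OF continuous_on_power_diff[OF True]]) (use Suc.prems in auto)
  next
    case False
    with Suc.prems show ?thesis
      by (intro continuous_at_imp_continuous_on ballI DERIV_isCont[OF power_diff_has_derivative]) auto
  qed
  have deriv: "(power_diff n q has_real_derivative q * power_diff n (q - 1) y) (at y)" if "x < y" for y
    using that Suc.prems by (intro power_diff_has_derivative) auto
  then have "\<exists>l \<eta>. x < \<eta> \<and> \<eta> < x + 1 \<and> DERIV (power_diff n q) \<eta> :> l \<and>
      power_diff n q (x + 1) - power_diff n q x = (x + 1 - x) * l"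
    by (intro MVT cont) (auto simp: real_differentiable_def)
  then obtain l \<eta> where \<eta>: "x < \<eta>" "\<eta> < x + 1" and d: "DERIV (power_diff n q) \<eta> :> l"
    and l: "power_diff (Suc n) q x = l" by auto
  have eq: "power_diff (Suc n) q x = q * power_diff n (q - 1) \<eta>"
    using DERIV_unique[OF deriv[OF \<eta>(1)] d] l by simp
  from Suc.IH[of \<eta> "q - 1"] \<eta> Suc.prems obtain \<xi> where
    "\<eta> \<le> \<xi>" "\<xi> \<le> \<eta> + real n" "0 < \<xi>"
    "power_diff n (q - 1) \<eta> = (\<Prod>i<n. q - 1 - real i) * \<xi> powr (q - 1 - real n)" by auto
  moreover have "(\<Prod>i<Suc n. q - real i) = q * (\<Prod>i<n. q - 1 - real i)"
    by (simp add: prod.lessThan_Suc_shift algebra_simps del: prod.lessThan_Suc)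
  ultimately show ?case using \<eta> eq
    by (intro exI[of _ \<xi>]) (auto simp: algebra_simps)
qed

section \<open>The spectrum of the covariance matrix of fractional Gaussian noise\<close>

text \<open>The autocovariance of the increments of fractional Brownian motion over unit steps, with \<open>p = 2 * H\<close>.\<close>
definition fgn_acf :: "real \<Rightarrow> nat \<Rightarrow> real" where
  "fgn_acf p k = ((real k + 1) powr p + \<bar>real k - 1\<bar> powr p - 2 * real k powr p) / 2"

lemma fgn_acf_Suc: "fgn_acf p (Suc k) = power_diff 2 p (real k) / 2"
  by (simp add: fgn_acf_def eval_nat_numeral algebra_simps)

abbreviation lag :: "nat \<Rightarrow> nat \<Rightarrow> nat" where
  "lag i j \<equiv> nat \<bar>int i - int j\<bar>"

lemma fgn_cov_entry:
  assumes "i < N" "j < N"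
  shows "fgn_cov H \<delta> N $$ (i, j) = \<delta> powr (2 * H) * fgn_acf (2 * H) (lag i j)"
proof -
  have "real (lag i j) = \<bar>real i - real j\<bar>" by linarith
  with assms show ?thesis by (simp add: fgn_cov_def fgn_acf_def Let_def)
qed

text \<open>Since \<open>a i * a j\<close> is at most the mean of the two squares and the coefficients off the diagonal are nonpositive,
replacing products by means of squares lowers the quadratic form and leaves a diagonal one, whose
coefficients are the row sums. This is Gershgorin's bound for a matrix of this sign pattern.\<close>
lemma row_sum_bound:
  fixes c :: "nat \<Rightarrow> nat \<Rightarrow> real" and a :: "nat \<Rightarrow> real"
  assumes sym: "\<And>i j. c i j = c j i" and off: "\<And>i j. i \<noteq> j \<Longrightarrow> c i j \<le> 0"
  shows "(\<Sum>i<N. (\<Sum>j<N. c i j) * (a i)\<^sup>2) \<le> (\<Sum>i<N. \<Sum>j<N. c i j * (a i * a j))"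
proof -
  have swap: "(\<Sum>i<N. \<Sum>j<N. c i j * (a j)\<^sup>2) = (\<Sum>i<N. \<Sum>j<N. c i j * (a i)\<^sup>2)"
    by (subst sum.swap) (simp add: sym)
  have "c i j * (((a i)\<^sup>2 + (a j)\<^sup>2) / 2) \<le> c i j * (a i * a j)" for i j
  proof (cases "i = j")
    case False
    have "a i * a j \<le> ((a i)\<^sup>2 + (a j)\<^sup>2) / 2"
      using sum_squares_bound[of "a i" "a j"] by simp
    then show ?thesis using off[OF False] by (rule mult_left_mono_neg)
  qed (simp add: power2_eq_square)
  then have "(\<Sum>i<N. \<Sum>j<N. c i j * (((a i)\<^sup>2 + (a j)\<^sup>2) / 2)) \<le> (\<Sum>i<N. \<Sum>j<N. c i j * (a i * a j))"
    by (intro sum_mono)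
  also have "(\<Sum>i<N. \<Sum>j<N. c i j * (((a i)\<^sup>2 + (a j)\<^sup>2) / 2)) =
      ((\<Sum>i<N. \<Sum>j<N. c i j * (a i)\<^sup>2) + (\<Sum>i<N. \<Sum>j<N. c i j * (a j)\<^sup>2)) / 2"
    by (simp add: sum.distrib sum_divide_distrib distrib_left add_divide_distrib)
  finally show ?thesis by (simp add: swap sum_distrib_right)
qed

text \<open>Each entry is half a second difference of \<open>\<bar>x\<bar> powr p\<close>, so a row sum telescopes to half of two
first differences, taken at the two ends of the row. By concavity each of them is at least the derivative at \<open>N\<close>.\<close>
lemma fgn_acf_row_sum:
  assumes p: "0 < p" "p \<le> 1" and i: "i < N"
  shows "p * real N powr (p - 1) \<le> (\<Sum>j<N. fgn_acf p (lag i j))"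
proof -
  define u where "u j = \<bar>real i - real j + 1\<bar> powr p - \<bar>real i - real j\<bar> powr p" for j :: nat
  have step: "2 * fgn_acf p (lag i j) = u j - u (Suc j)" for j
  proof -
    have [simp]: "real (lag i j) = \<bar>real i - real j\<bar>" by linarith
    have *: "(\<bar>x\<bar> + 1) powr p + \<bar>\<bar>x\<bar> - 1\<bar> powr p = \<bar>x + 1\<bar> powr p + \<bar>x - 1\<bar> powr p" for x :: real
    proof (cases "0 \<le> x")
      case False
      then have "\<bar>x\<bar> + 1 = \<bar>x - 1\<bar>" "\<bar>\<bar>x\<bar> - 1\<bar> = \<bar>x + 1\<bar>" by auto
      then show ?thesis by (simp only: add.commute)
    qed simp
    show ?thesis using *[of "real i - real j"] unfolding fgn_acf_def u_def
      by (simp add: field_simps)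
  qed
  have "2 * (\<Sum>j<N. fgn_acf p (lag i j)) = (\<Sum>j<N. u j - u (Suc j))"
    by (simp add: sum_distrib_left step)
  also have "\<dots> = u 0 - u N" by (rule sum_lessThan_telescope')
  also have "u 0 = power_diff 1 p (real i)" by (simp add: u_def)
  finally have "2 * (\<Sum>j<N. fgn_acf p (lag i j)) = power_diff 1 p (real i) - u N" .
  moreover have "- u N = power_diff 1 p (real (N - 1 - i))"
  proof -
    have "\<bar>real i - real N + 1\<bar> = real (N - 1 - i)" "\<bar>real i - real N\<bar> = real (N - 1 - i) + 1"
      using i by linarith+
    then show ?thesis by (simp add: u_def)
  qed
  ultimately have tot: "2 * (\<Sum>j<N. fgn_acf p (lag i j)) =
      power_diff 1 p (real i) + power_diff 1 p (real (N - 1 - i))" by simp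
  have "p * real N powr (p - 1) \<le> power_diff 1 p (real k)" if "k < N" for k
  proof -
    obtain \<xi> where "0 < \<xi>" "\<xi> \<le> real k + 1" "power_diff 1 p (real k) = p * \<xi> powr (p - 1)"
      using power_diff_mean_value[of "real k" p 1] p by auto
    moreover have "real k + 1 \<le> real N" using that by linarith
    ultimately show ?thesis using p by (auto intro!: mult_left_mono powr_mono2')
  qed
  from this[of i] this[of "N - 1 - i"] i tot show ?thesis by simp
qed

lemma fgn_quadratic_form_bound_antipersistent:
  fixes a :: "nat \<Rightarrow> real"
  assumes p: "0 < p" "p \<le> 1"
  shows "p * real N powr (p - 1) * (\<Sum>i<N. (a i)\<^sup>2)
    \<le> (\<Sum>i<N. \<Sum>j<N. fgn_acf p (lag i j) * (a i * a j))"
proof -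
  have off: "fgn_acf p (lag i j) \<le> 0" if neq: "i \<noteq> j" for i j
  proof -
    obtain k where k: "lag i j = Suc k" using neq by (cases "lag i j") auto
    obtain \<xi> where "power_diff 2 p (real k) = p * (p - 1) * \<xi> powr (p - 2)"
      using power_diff_mean_value[of "real k" p 2] p by (auto simp: lessThan_nat_numeral mult_ac)
    then show ?thesis unfolding k fgn_acf_Suc using p by (auto simp: mult_le_0_iff)
  qed
  have "p * real N powr (p - 1) * (\<Sum>i<N. (a i)\<^sup>2) = (\<Sum>i<N. p * real N powr (p - 1) * (a i)\<^sup>2)"
    by (simp add: sum_distrib_left)
  also have "\<dots> \<le> (\<Sum>i<N. (\<Sum>j<N. fgn_acf p (lag i j)) * (a i)\<^sup>2)"
    using fgn_acf_row_sum[OF p] by (intro sum_mono mult_right_mono) auto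
  also have "\<dots> \<le> (\<Sum>i<N. \<Sum>j<N. fgn_acf p (lag i j) * (a i * a j))"
    by (rule row_sum_bound) (auto simp: off abs_minus_commute)
  finally show ?thesis .
qed

text \<open>Two windows of length \<open>m\<close> that start at \<open>i\<close> and \<open>j\<close> overlap in \<open>m - lag i j\<close> points; the truncated
subtraction covers disjoint windows.\<close>
lemma sum_window_indicators:
  fixes m :: nat
  assumes "i < N" "j < N"
  shows "(\<Sum>l<N + m. of_bool (l \<in> {i..<i + m}) * of_bool (l \<in> {j..<j + m})) = real (m - lag i j)"
proof -
  have "(\<Sum>l<N + m. of_bool (l \<in> {i..<i + m}) * of_bool (l \<in> {j..<j + m}) :: real) =
      (\<Sum>l<N + m. if l \<in> {max i j..<min i j + m} then 1 else 0)"
    by (intro sum.cong) auto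
  also have "\<dots> = real (card ({..<N + m} \<inter> {max i j..<min i j + m}))"
    by (simp only: sum.If_cases finite_lessThan Collect_mem_eq) simp
  also have "{..<N + m} \<inter> {max i j..<min i j + m} = {max i j..<min i j + m}"
    using assms by auto
  also have "card {max i j..<min i j + m} = m - lag i j" 
    by (simp only: card_atLeastLessThan)
  finally show ?thesis .
qed

text \<open>The triangular kernel is the Gram matrix of the window indicators.\<close>
lemma triangle_kernel_nonneg:
  fixes a :: "nat \<Rightarrow> real"
  shows "0 \<le> (\<Sum>i<N. \<Sum>j<N. real (m - lag i j) * (a i * a j))"
proof -
  define b where "b l i = (of_bool (l \<in> {i..<i + m}) :: real)" for l i
  have "(\<Sum>i<N. \<Sum>j<N. real (m - lag i j) * (a i * a j)) =
      (\<Sum>i<N. \<Sum>j<N. (\<Sum>l<N + m. b l i * b l j) * (a i * a j))"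
    unfolding b_def by (intro sum.cong refl) (subst sum_window_indicators, auto)
  also have "\<dots> = (\<Sum>i<N. \<Sum>j<N. \<Sum>l<N + m. (b l i * a i) * (b l j * a j))"
    by (simp add: sum_distrib_right sum_distrib_left mult_ac)
  also have "\<dots> = (\<Sum>l<N + m. \<Sum>i<N. \<Sum>j<N. (b l i * a i) * (b l j * a j))"
    by (simp only: sum.swap[of _ "{..<N + m}"])
  also have "\<dots> = (\<Sum>l<N + m. (\<Sum>i<N. b l i * a i)\<^sup>2)"
    by (simp add: power2_eq_square sum_product)
  finally show ?thesis by (simp add: sum_nonneg)
qed

text \<open>Expansion around the right end \<open>K\<close>: truncated subtraction makes the sum start at \<open>m = k\<close>. It writes a
sequence as a constant plus a combination of triangles \<open>M - k\<close>, whose coefficients are the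
second differences and one first difference.\<close>
lemma discrete_taylor:
  fixes r :: "nat \<Rightarrow> real"
  assumes "k \<le> K"
  shows "r k = r K + real (K - k) * (r K - r (Suc K)) +
    (\<Sum>m<K. real (Suc m - k) * (r m - 2 * r (Suc m) + r (Suc (Suc m))))"
  using assms
proof (induction K rule: dec_induct)
  case base
  have "(\<Sum>m<k. real (Suc m - k) * (r m - 2 * r (Suc m) + r (Suc (Suc m)))) = 0"
    by (intro sum.neutral) auto
  then show ?case by simp
next
  case (step K)
  then show ?case by (simp add: of_nat_diff algebra_simps)
qed

text \<open>Polya's criterion: the expansion above is a combination of positive semidefinite kernels (a constant and
triangles), and the hypotheses say that its coefficients are nonnegative.\<close>
lemma polya_nonneg:
  fixes r a :: "nat \<Rightarrow> real"
  assumes nonneg: "\<And>k. 0 \<le> r k" and decr: "\<And>k. r (Suc k) \<le> r k"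
    and convex: "\<And>k. 2 * r (Suc k) \<le> r k + r (Suc (Suc k))"
  shows "0 \<le> (\<Sum>i<N. \<Sum>j<N. r (lag i j) * (a i * a j))"
proof -
  define d where "d m = r m - 2 * r (Suc m) + r (Suc (Suc m))" for m
  define e where "e = r N - r (Suc N)"
  define h where "h m i j = real (m - lag i j)" for m i j
  have "r (lag i j) = r N + h N i j * e + (\<Sum>m<N. h (Suc m) i j * d m)" if "i < N" "j < N" for i j
    unfolding d_def e_def h_def using that by (intro discrete_taylor) auto
  then have "(\<Sum>i<N. \<Sum>j<N. r (lag i j) * (a i * a j)) =
      (\<Sum>i<N. \<Sum>j<N. (r N + h N i j * e + (\<Sum>m<N. h (Suc m) i j * d m)) * (a i * a j))"
    by (intro sum.cong refl arg_cong2[where f = "(*)"]) auto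
  also have "\<dots> = r N * (\<Sum>i<N. \<Sum>j<N. a i * a j) +
      e * (\<Sum>i<N. \<Sum>j<N. h N i j * (a i * a j)) +
      (\<Sum>i<N. \<Sum>j<N. \<Sum>m<N. d m * (h (Suc m) i j * (a i * a j)))"
    by (simp add: algebra_simps sum.distrib sum_distrib_left)
  also have "(\<Sum>i<N. \<Sum>j<N. \<Sum>m<N. d m * (h (Suc m) i j * (a i * a j))) =
      (\<Sum>m<N. d m * (\<Sum>i<N. \<Sum>j<N. h (Suc m) i j * (a i * a j)))"
  proof -
    have "(\<Sum>i<N. \<Sum>j<N. \<Sum>m<N. d m * (h (Suc m) i j * (a i * a j))) =
        (\<Sum>i<N. \<Sum>m<N. \<Sum>j<N. d m * (h (Suc m) i j * (a i * a j)))"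
      by (rule sum.cong[OF refl]) (rule sum.swap)
    also have "\<dots> = (\<Sum>m<N. \<Sum>i<N. \<Sum>j<N. d m * (h (Suc m) i j * (a i * a j)))"
      by (rule sum.swap)
    finally show ?thesis by (simp add: sum_distrib_left)
  qed
  also have "(\<Sum>i<N. \<Sum>j<N. a i * a j) = (\<Sum>i<N. a i)\<^sup>2"
    by (simp add: power2_eq_square sum_product)
  finally have eq: "(\<Sum>i<N. \<Sum>j<N. r (lag i j) * (a i * a j)) =
      r N * (\<Sum>i<N. a i)\<^sup>2 + e * (\<Sum>i<N. \<Sum>j<N. h N i j * (a i * a j)) +
      (\<Sum>m<N. d m * (\<Sum>i<N. \<Sum>j<N. h (Suc m) i j * (a i * a j)))" .
  have "0 \<le> d m" for m using convex[of m] by (simp add: d_def)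
  moreover have "0 \<le> e" using decr[of N] by (simp add: e_def)
  moreover have "0 \<le> (\<Sum>i<N. \<Sum>j<N. h m i j * (a i * a j))" for m
    unfolding h_def by (rule triangle_kernel_nonneg)
  ultimately show ?thesis unfolding eq using nonneg[of N]
    by (intro add_nonneg_nonneg mult_nonneg_nonneg[of "r N"] mult_nonneg_nonneg[of e]
      sum_nonneg[of "{..<N}" "\<lambda>m. d m * _ m"] mult_nonneg_nonneg[of "d _"]) auto
qed

text \<open>The second difference \<open>\<rho> 0 - 2 * \<rho> 1 + \<rho> 2\<close> of the autocovariance \<open>\<rho>\<close>. Reducing \<open>\<rho> 0\<close> by this amount is
the largest change that keeps \<open>\<rho>\<close> convex.\<close>
definition fgn_slack :: "real \<Rightarrow> real" where
  "fgn_slack p = (7 - 4 * 2 powr p + 3 powr p) / 2"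

text \<open>The function vanishes at \<open>p = 2\<close>, where fractional Brownian motion degenerates to a random line, and
it is strictly decreasing up to there: as \<open>(3 / 2) powr p \<le> 9 / 4\<close>, its derivative is negative once
\<open>9 * ln 3 < 16 * ln 2\<close>, that is \<open>3 ^ 9 < 2 ^ 16\<close>.\<close>
lemma fgn_slack_pos:
  assumes "1 < p" "p < 2"
  shows "0 < fgn_slack p"
proof -
  define g where "g q = 7 - 4 * 2 powr q + 3 powr q" for q :: real
  have log: "9 * ln 3 < 16 * ln (2::real)"
  proof -
    have "9 * ln 3 = ln (3 ^ 9 :: real)" using ln_realpow[of "3::real" 9] by simp
    also have "\<dots> < ln (2 ^ 16)" by simp
    also have "\<dots> = 16 * ln (2::real)" using ln_realpow[of "2::real" 16] by simp
    finally show ?thesis .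
  qed
  have "\<exists>q>p. q < 2 \<and> g 2 - g p = (2 - p) * (3 powr q * ln 3 - 4 * 2 powr q * ln 2)"
    by (rule MVT2) (use assms in \<open>auto simp: g_def intro!: derivative_eq_intros\<close>)
  then obtain q where q: "p < q" "q < 2"
    and eq: "g 2 - g p = (2 - p) * (3 powr q * ln 3 - 4 * 2 powr q * ln 2)" by blast
  have "(3::real) powr q = 2 powr q * (3 / 2) powr q"
    by (simp add: powr_mult[symmetric])
  also have "(3 / 2 :: real) powr q \<le> (3 / 2) powr 2"
    using q by (intro powr_mono) auto
  finally have "(3::real) powr q \<le> 2 powr q * (9 / 4)"
    by (simp add: power2_eq_square)
  then have "3 powr q * ln 3 \<le> 2 powr q * (9 / 4) * ln (3::real)"
    by (intro mult_right_mono) auto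
  also have "\<dots> = 2 powr q * (9 * ln 3) / 4" by simp
  also have "\<dots> < 2 powr q * (16 * ln 2) / 4" using log by simp
  finally have "3 powr q * ln 3 - 4 * 2 powr q * ln (2::real) < 0" by (simp add: mult_ac)
  then have "(2 - p) * (3 powr q * ln 3 - 4 * 2 powr q * ln 2) < 0"
    using assms by (intro mult_pos_neg) auto
  then have "g 2 < g p" using eq by simp
  then show ?thesis by (simp add: g_def fgn_slack_def)
qed

text \<open>For positive lags the monotonicity and convexity of the autocovariance are sign statements about its
third and fourth differences as a power function. The second difference at lag 1 involves \<open>\<bar>-1\<bar> powr p\<close> and is not of
this form; the reduced sequence \<open>r\<close> is made to be exactly linear there.\<close>
lemma fgn_quadratic_form_bound_persistent:
  fixes a :: "nat \<Rightarrow> real"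
  assumes p: "1 < p" "p < 2"
  shows "fgn_slack p * (\<Sum>i<N. (a i)\<^sup>2)
    \<le> (\<Sum>i<N. \<Sum>j<N. fgn_acf p (lag i j) * (a i * a j))"
proof -
  \<comment> \<open>The second difference of \<open>r\<close> at lag 1 is 0 by the choice of \<open>fgn_slack\<close>.\<close>
  define r where "r k = fgn_acf p k - (if k = 0 then fgn_slack p else 0)" for k
  have pos: "0 < p" using p by simp
  have rSuc: "r (Suc k) = power_diff 2 p (real k) / 2" for k
    by (simp add: r_def fgn_acf_Suc)
  have diff1: "r (Suc k) - r (Suc (Suc k)) = - power_diff 3 p (real k) / 2" for k
    by (simp add: rSuc eval_nat_numeral field_simps)
  have diff2: "r (Suc k) + r (Suc (Suc (Suc k))) - 2 * r (Suc (Suc k)) = power_diff 4 p (real k) / 2" for k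
    by (simp add: rSuc eval_nat_numeral field_simps)
  have r0: "r 0 + r 2 = 2 * r 1"
    by (simp add: r_def fgn_acf_def fgn_slack_def field_simps)
  have nonnegS: "0 \<le> r (Suc k)" for k
  proof -
    obtain \<xi> where "power_diff 2 p (real k) = p * (p - 1) * \<xi> powr (p - 2)"
      using power_diff_mean_value[of "real k" p 2] pos by (auto simp: lessThan_nat_numeral mult_ac)
    then show ?thesis using p by (simp add: rSuc)
  qed
  have decrS: "r (Suc (Suc k)) \<le> r (Suc k)" for k
  proof -
    obtain \<xi> where "power_diff 3 p (real k) = p * (p - 1) * (p - 2) * \<xi> powr (p - 3)"
      using power_diff_mean_value[of "real k" p 3] pos by (auto simp: lessThan_nat_numeral mult_ac)
    moreover have "p * (p - 1) * (p - 2) * \<xi> powr (p - 3) \<le> 0"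
      using p by (intro mult_nonpos_nonneg mult_nonneg_nonpos) auto
    ultimately show ?thesis using diff1[of k] by simp
  qed
  have convS: "2 * r (Suc (Suc k)) \<le> r (Suc k) + r (Suc (Suc (Suc k)))" for k
  proof -
    obtain \<xi> where "power_diff 4 p (real k) = p * (p - 1) * ((p - 2) * (p - 3)) * \<xi> powr (p - 4)"
      using power_diff_mean_value[of "real k" p 4] pos by (auto simp: lessThan_nat_numeral mult_ac)
    moreover have "0 \<le> (p - 2) * (p - 3)" using p by (intro mult_nonpos_nonpos) auto
    ultimately have "0 \<le> power_diff 4 p (real k)" using p by simp
    then show ?thesis using diff2[of k] by simp
  qed
  have r01: "r 1 \<le> r 0" using r0 decrS[of 0] by (simp add: numeral_2_eq_2)
  have "0 \<le> (\<Sum>i<N. \<Sum>j<N. r (lag i j) * (a i * a j))"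
  proof (rule polya_nonneg)
    fix k
    show "0 \<le> r k" using nonnegS order_trans[OF nonnegS[of 0]] r01 by (cases k) auto
    show "r (Suc k) \<le> r k" using decrS r01 by (cases k) auto
    show "2 * r (Suc k) \<le> r k + r (Suc (Suc k))"
      using convS r0 by (cases k) (auto simp: numeral_2_eq_2)
  qed
  also have "\<dots> = (\<Sum>i<N. \<Sum>j<N. fgn_acf p (lag i j) * (a i * a j)) - fgn_slack p * (\<Sum>i<N. (a i)\<^sup>2)"
  proof -
    have "(\<Sum>j<N. (if lag i j = 0 then fgn_slack p else 0) * (a i * a j)) = fgn_slack p * (a i)\<^sup>2"
      if "i < N" for i
    proof -
      have "(\<Sum>j<N. (if lag i j = 0 then fgn_slack p else 0) * (a i * a j)) =
          (\<Sum>j<N. if i = j then fgn_slack p * (a i * a j) else 0)"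
        by (intro sum.cong) auto
      then show ?thesis using that by (simp add: power2_eq_square)
    qed
    then show ?thesis
      by (simp add: r_def left_diff_distrib sum_subtractf sum_distrib_left)
  qed
  finally show ?thesis by simp
qed

section \<open>Bounds for the estimator\<close>
lemma coercive_mat_inverse:
  fixes P :: "real mat"
  assumes P: "P \<in> carrier_mat n n" and pos: "0 < c"
    and coercive: "\<And>v. v \<in> carrier_vec n \<Longrightarrow> c * (v \<bullet> v) \<le> v \<bullet> (P *\<^sub>v v)"
  obtains Q where "mat_inverse P = Some Q" "Q \<in> carrier_mat n n" "P * Q = 1\<^sub>m n"
proof -
  have sq: "v \<bullet> v = (\<Sum>i<n. (v $ i)\<^sup>2)" if "v \<in> carrier_vec n" for v :: "real vec"
    using that by (auto simp: scalar_prod_def power2_eq_square lessThan_atLeast0)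
  have "Determinant.det P \<noteq> 0"
  proof
    assume "Determinant.det P = 0"
    then obtain v where v: "v \<in> carrier_vec n" "v \<noteq> 0\<^sub>v n" "P *\<^sub>v v = 0\<^sub>v n"
      using det_0_iff_vec_prod_zero[OF P] by auto
    have "c * (v \<bullet> v) \<le> 0" using coercive[OF v(1)] v by simp
    then have "v \<bullet> v \<le> 0" using pos by (simp add: mult_le_0_iff)
    then have "(\<Sum>i<n. (v $ i)\<^sup>2) = 0" unfolding sq[OF v(1)]
      by (intro antisym sum_nonneg) auto
    then have "\<forall>i<n. v $ i = 0" by (subst (asm) sum_nonneg_eq_0_iff) auto
    then have "v = 0\<^sub>v n" using v(1) by auto
    with v(2) show False by simp
  qed
  then have "P \<in> Units (ring_mat TYPE(real) n ())" by (rule det_non_zero_imp_unit[OF P])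
  then obtain Q where "mat_inverse P = Some Q"
    using mat_inverse(1)[OF P, where b = "()"] by (cases "mat_inverse P") auto
  with mat_inverse(2)[OF P] that show ?thesis by auto
qed

text \<open>With \<open>y = P\<^sup>-\<^sup>1 x\<close> coercivity reads \<open>c * (y \<bullet> y) \<le> x \<bullet> y\<close>, and Young's inequality absorbs \<open>y \<bullet> y\<close>.\<close>
lemma inverse_quadratic_form_bound:
  fixes P Q :: "real mat" and x :: "real vec"
  assumes P: "P \<in> carrier_mat n n" and Qc: "Q \<in> carrier_mat n n" and PQ: "P * Q = 1\<^sub>m n"
    and pos: "0 < c" and x: "x \<in> carrier_vec n"
    and coercive: "\<And>v. v \<in> carrier_vec n \<Longrightarrow> c * (v \<bullet> v) \<le> v \<bullet> (P *\<^sub>v v)"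
  shows "0 \<le> x \<bullet> (Q *\<^sub>v x)"
    and "x \<bullet> (Q *\<^sub>v x) \<le> (x \<bullet> x) / c"
proof -
  have sq: "v \<bullet> v = (\<Sum>i<n. (v $ i)\<^sup>2)" if "v \<in> carrier_vec n" for v :: "real vec"
    using that by (auto simp: scalar_prod_def power2_eq_square lessThan_atLeast0)
  define y where "y = Q *\<^sub>v x"
  have y: "y \<in> carrier_vec n" using Qc x by (simp add: y_def)
  have "P *\<^sub>v y = (P * Q) *\<^sub>v x" unfolding y_def using P Qc x by simp
  then have Py: "P *\<^sub>v y = x" using PQ x by simp
  have le: "c * (y \<bullet> y) \<le> x \<bullet> y"
    using coercive[OF y] Py comm_scalar_prod[OF y x] by simp
  have "0 \<le> y \<bullet> y" unfolding sq[OF y] by (intro sum_nonneg) auto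
  then have "0 \<le> c * (y \<bullet> y)" using pos by simp
  with le show "0 \<le> x \<bullet> (Q *\<^sub>v x)" by (simp add: y_def)
  have "2 * (x \<bullet> y) \<le> (x \<bullet> x) / c + c * (y \<bullet> y)"
  proof -
    have "2 * (x $ i * y $ i) \<le> (x $ i)\<^sup>2 / c + c * (y $ i)\<^sup>2" for i
    proof -
      have "0 \<le> (x $ i - c * y $ i)\<^sup>2 / c" using pos by simp
      also have "\<dots> = (x $ i)\<^sup>2 / c + c * (y $ i)\<^sup>2 - 2 * (x $ i * y $ i)"
        using pos by (simp add: power2_eq_square field_simps)
      finally show ?thesis by simp
    qed
    then have "(\<Sum>i<n. 2 * (x $ i * y $ i)) \<le> (\<Sum>i<n. (x $ i)\<^sup>2 / c + c * (y $ i)\<^sup>2)"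
      by (intro sum_mono)
    then show ?thesis unfolding sq[OF x] sq[OF y] using y
      by (simp add: scalar_prod_def lessThan_atLeast0 sum_distrib_left sum.distrib sum_divide_distrib)
  qed
  with le show "x \<bullet> (Q *\<^sub>v x) \<le> (x \<bullet> x) / c" by (simp add: y_def)
qed

text \<open>A lower bound for the smallest eigenvalue of the \<open>N\<close> by \<open>N\<close> covariance matrix for unit steps.\<close>
definition fgn_eigenvalue_bound :: "real \<Rightarrow> nat \<Rightarrow> real" where
  "fgn_eigenvalue_bound H N =
     (if 2 * H \<le> 1 then 2 * H * real N powr (2 * H - 1) else fgn_slack (2 * H))"

lemma fgn_eigenvalue_bound_pos:
  assumes "0 < H" "H < 1" "0 < N"
  shows "0 < fgn_eigenvalue_bound H N"
  using assms fgn_slack_pos[of "2 * H"] by (auto simp: fgn_eigenvalue_bound_def)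

lemma fgn_cov_carrier: "fgn_cov H \<delta> N \<in> carrier_mat N N"
  by (simp add: fgn_cov_def)

lemma fgn_cov_coercive:
  assumes H: "0 < H" "H < 1" and v: "v \<in> carrier_vec N"
  shows "\<delta> powr (2 * H) * fgn_eigenvalue_bound H N * (v \<bullet> v) \<le> v \<bullet> (fgn_cov H \<delta> N *\<^sub>v v)"
proof -
  let ?q = "\<Sum>i<N. \<Sum>j<N. fgn_acf (2 * H) (lag i j) * (v $ i * v $ j)"
  have "fgn_eigenvalue_bound H N * (\<Sum>i<N. (v $ i)\<^sup>2) \<le> ?q"
    using fgn_quadratic_form_bound_antipersistent[of "2 * H" N "\<lambda>i. v $ i"]
      fgn_quadratic_form_bound_persistent[of "2 * H" "\<lambda>i. v $ i" N] H
    by (auto simp: fgn_eigenvalue_bound_def)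
  then have "\<delta> powr (2 * H) * (fgn_eigenvalue_bound H N * (\<Sum>i<N. (v $ i)\<^sup>2)) \<le> \<delta> powr (2 * H) * ?q"
    by (intro mult_left_mono) auto
  moreover have "v \<bullet> v = (\<Sum>i<N. (v $ i)\<^sup>2)"
    using v by (auto simp: scalar_prod_def power2_eq_square lessThan_atLeast0)
  moreover have "v \<bullet> (fgn_cov H \<delta> N *\<^sub>v v) = \<delta> powr (2 * H) * ?q"
  proof -
    have "(fgn_cov H \<delta> N *\<^sub>v v) $ i = (\<Sum>j<N. fgn_cov H \<delta> N $$ (i, j) * v $ j)" if "i < N" for i
      using that v fgn_cov_carrier[of H \<delta> N] by (auto simp: scalar_prod_def lessThan_atLeast0)
    then have "v \<bullet> (fgn_cov H \<delta> N *\<^sub>v v) = (\<Sum>i<N. v $ i * (\<Sum>j<N. fgn_cov H \<delta> N $$ (i, j) * v $ j))"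
      using fgn_cov_carrier[of H \<delta> N] by (simp add: scalar_prod_def lessThan_atLeast0[symmetric])
    then show ?thesis by (simp add: fgn_cov_entry sum_distrib_left mult_ac)
  qed
  ultimately show ?thesis by (simp add: mult.assoc)
qed

lemma sigma2_hat_expand:
  assumes H: "0 < H" "H < 1" and "0 < \<delta>" "0 < N"
  obtains Q where "Q \<in> carrier_mat N N" "fgn_cov H \<delta> N * Q = 1\<^sub>m N"
    "\<And>z. sigma2_hat H \<delta> N z = 1 / real N * (increments \<delta> N z \<bullet> (Q *\<^sub>v increments \<delta> N z))"
proof -
  have "0 < \<delta> powr (2 * H) * fgn_eigenvalue_bound H N"
    using fgn_eigenvalue_bound_pos assms by simp
  from coercive_mat_inverse[OF fgn_cov_carrier this fgn_cov_coercive[OF H]]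
  obtain Q where "mat_inverse (fgn_cov H \<delta> N) = Some Q" "Q \<in> carrier_mat N N"
    "fgn_cov H \<delta> N * Q = 1\<^sub>m N" by blast
  then show ?thesis by (intro that[of Q]) (auto simp: sigma2_hat_def)
qed

lemma sigma2_hat_bounds:
  assumes H: "0 < H" "H < 1" and \<delta>: "0 < \<delta>" and N: "0 < N"
  shows "0 \<le> sigma2_hat H \<delta> N z"
    and "sigma2_hat H \<delta> N z \<le> (\<Sum>i<N. (z ((real i + 1) * \<delta>) - z (real i * \<delta>))\<^sup>2) /
      (real N * (\<delta> powr (2 * H) * fgn_eigenvalue_bound H N))"
proof -
  define c where "c = \<delta> powr (2 * H) * fgn_eigenvalue_bound H N"
  have c: "0 < c" using fgn_eigenvalue_bound_pos[OF H N] \<delta> by (simp add: c_def)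
  obtain Q where Q: "Q \<in> carrier_mat N N" "fgn_cov H \<delta> N * Q = 1\<^sub>m N"
    and eq: "\<And>z. sigma2_hat H \<delta> N z = 1 / real N * (increments \<delta> N z \<bullet> (Q *\<^sub>v increments \<delta> N z))"
    using sigma2_hat_expand[OF H \<delta> N] by blast
  let ?x = "increments \<delta> N z"
  have x: "?x \<in> carrier_vec N" by (simp add: increments_def)
  have "?x \<bullet> ?x = (\<Sum>i<N. (z ((real i + 1) * \<delta>) - z (real i * \<delta>))\<^sup>2)"
    by (simp add: increments_def scalar_prod_def power2_eq_square lessThan_atLeast0)
  moreover have "c * (v \<bullet> v) \<le> v \<bullet> (fgn_cov H \<delta> N *\<^sub>v v)" if "v \<in> carrier_vec N" for v
    unfolding c_def by (rule fgn_cov_coercive[OF H that])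
  moreover note inverse_quadratic_form_bound[OF fgn_cov_carrier Q c x this]
  ultimately have "0 \<le> ?x \<bullet> (Q *\<^sub>v ?x)"
    "?x \<bullet> (Q *\<^sub>v ?x) \<le> (\<Sum>i<N. (z ((real i + 1) * \<delta>) - z (real i * \<delta>))\<^sup>2) / c" by simp_all
  then show "0 \<le> sigma2_hat H \<delta> N z"
    and "sigma2_hat H \<delta> N z \<le> (\<Sum>i<N. (z ((real i + 1) * \<delta>) - z (real i * \<delta>))\<^sup>2) /
      (real N * (\<delta> powr (2 * H) * fgn_eigenvalue_bound H N))"
    using N c unfolding eq c_def[symmetric] by (simp_all add: field_simps)
qed

lemma sigma2_hat_measurable:
  assumes H: "0 < H" "H < 1" and \<delta>: "0 < \<delta>" and N: "0 < N"
    and X: "\<And>t. 0 \<le> t \<Longrightarrow> X t \<in> borel_measurable M"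
  shows "(\<lambda>\<omega>. sigma2_hat H \<delta> N (\<lambda>t. X t \<omega>)) \<in> borel_measurable M"
proof -
  obtain Q where Q: "Q \<in> carrier_mat N N"
    and eq: "\<And>z. sigma2_hat H \<delta> N z = 1 / real N * (increments \<delta> N z \<bullet> (Q *\<^sub>v increments \<delta> N z))"
    using sigma2_hat_expand[OF H \<delta> N] by blast
  define D where "D i \<omega> = X ((real i + 1) * \<delta>) \<omega> - X (real i * \<delta>) \<omega>" for i \<omega>
  have [measurable]: "D i \<in> borel_measurable M" for i
    unfolding D_def using \<delta> by (intro borel_measurable_diff X) auto
  have "sigma2_hat H \<delta> N (\<lambda>t. X t \<omega>) = 1 / real N * (\<Sum>i<N. D i \<omega> * (\<Sum>j<N. Q $$ (i, j) * D j \<omega>))" for \<omega>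
  proof -
    have "increments \<delta> N (\<lambda>t. X t \<omega>) = Matrix.vec N (\<lambda>i. D i \<omega>)"
      by (simp add: increments_def D_def)
    then show ?thesis unfolding eq using Q
      by (simp add: scalar_prod_def lessThan_atLeast0)
  qed
  then show ?thesis by simp
qed

text \<open>For \<open>2 * H \<le> 1\<close> the eigenvalue bound degrades like \<open>N powr (2 * H - 1)\<close>. Along \<open>N * \<delta> = T\<close> this costs a
factor \<open>\<delta> powr (2 * H - 1)\<close> and turns the rate \<open>\<delta> powr (2 - 2 * H)\<close> into \<open>\<delta>\<close>.\<close>
lemma sigma2_hat_rate:
  assumes H: "0 < H" "H < 1" and T: "0 < T"
  obtains K where "0 < K" "\<And>\<delta> N. 0 < \<delta> \<Longrightarrow> 0 < N \<Longrightarrow> real N * \<delta> = T \<Longrightarrow>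
    \<delta>\<^sup>2 / (\<delta> powr (2 * H) * fgn_eigenvalue_bound H N) = K * \<delta> powr min 1 (2 * (1 - H))"
proof (cases "2 * H \<le> 1")
  case True
  show ?thesis
  proof (rule that[of "T powr (1 - 2 * H) / (2 * H)"])
    show "0 < T powr (1 - 2 * H) / (2 * H)" using T H by simp
    fix \<delta> :: real and N :: nat assume \<delta>: "0 < \<delta>" and N: "0 < N" and T_eq: "real N * \<delta> = T"
    have "\<delta> powr (2 * H) * real N powr (2 * H - 1) * (T powr (1 - 2 * H) * \<delta>) =
        \<delta> powr (2 * H) * \<delta> powr (1 - 2 * H) * (real N powr (2 * H - 1) * real N powr (1 - 2 * H)) * \<delta>"
      unfolding T_eq[symmetric] using \<delta> by (simp add: powr_mult)
    also have "\<dots> = \<delta>\<^sup>2"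
      using \<delta> N by (simp only: powr_add[symmetric]) (simp add: power2_eq_square)
    finally have key: "\<delta>\<^sup>2 = \<delta> powr (2 * H) * real N powr (2 * H - 1) * (T powr (1 - 2 * H) * \<delta>)" ..
    have "min 1 (2 * (1 - H)) = 1" using True by simp
    then show "\<delta>\<^sup>2 / (\<delta> powr (2 * H) * fgn_eigenvalue_bound H N) =
        T powr (1 - 2 * H) / (2 * H) * \<delta> powr min 1 (2 * (1 - H))"
      unfolding key using True \<delta> N H by (simp add: fgn_eigenvalue_bound_def)
  qed
next
  case False
  have slack: "0 < fgn_slack (2 * H)" using False H by (intro fgn_slack_pos) auto
  show ?thesis
  proof (rule that[of "1 / fgn_slack (2 * H)"])
    show "0 < 1 / fgn_slack (2 * H)" using slack by simp
    fix \<delta> :: real and N :: nat assume \<delta>: "0 < \<delta>"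
    have "\<delta>\<^sup>2 = \<delta> powr (2 * H) * \<delta> powr (2 * (1 - H))"
      using \<delta> by (simp add: powr_add[symmetric] algebra_simps)
    moreover have "min 1 (2 * (1 - H)) = 2 * (1 - H)" using False by simp
    ultimately show "\<delta>\<^sup>2 / (\<delta> powr (2 * H) * fgn_eigenvalue_bound H N) =
        1 / fgn_slack (2 * H) * \<delta> powr min 1 (2 * (1 - H))"
      using False \<delta> by (simp add: fgn_eigenvalue_bound_def)
  qed
qed

lemma sigma2_hat_le_of_increments:
  assumes H: "0 < H" "H < 1" and \<delta>: "0 < \<delta>" and N: "0 < N"
    and inc: "\<And>i. i < N \<Longrightarrow> \<bar>z ((real i + 1) * \<delta>) - z (real i * \<delta>)\<bar> \<le> C * \<delta>"
  shows "sigma2_hat H \<delta> N z \<le> C\<^sup>2 * (\<delta>\<^sup>2 / (\<delta> powr (2 * H) * fgn_eigenvalue_bound H N))"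
proof -
  define c where "c = \<delta> powr (2 * H) * fgn_eigenvalue_bound H N"
  have c: "0 < c" using fgn_eigenvalue_bound_pos[OF H N] \<delta> by (simp add: c_def)
  have "(\<Sum>i<N. (z ((real i + 1) * \<delta>) - z (real i * \<delta>))\<^sup>2) \<le> (\<Sum>i<N. (C * \<delta>)\<^sup>2)"
    using inc by (intro sum_mono abs_le_square_iff[THEN iffD1] order_trans[OF inc abs_ge_self]) auto
  then have "(\<Sum>i<N. (z ((real i + 1) * \<delta>) - z (real i * \<delta>))\<^sup>2) / (real N * c) \<le> (\<Sum>i<N. (C * \<delta>)\<^sup>2) / (real N * c)"
    using c by (intro divide_right_mono) auto
  also have "\<dots> = C\<^sup>2 * (\<delta>\<^sup>2 / c)" using N by (simp add: power_mult_distrib)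
  finally show ?thesis using sigma2_hat_bounds(2)[OF H \<delta> N, of z] unfolding c_def by linarith
qed

lemma sigma2_hat_tendsto_0:
  assumes H: "0 < H" "H < 1" and T: "0 < T"
    and lip: "\<And>s t. 0 \<le> s \<Longrightarrow> s \<le> t \<Longrightarrow> t \<le> T \<Longrightarrow> \<bar>z t - z s\<bar> \<le> C * (t - s)"
  shows "(\<lambda>N. sigma2_hat H (T / real N) N z) \<longlonglongrightarrow> 0"
proof -
  obtain K where "0 < K" and K: "\<And>\<delta> N. 0 < \<delta> \<Longrightarrow> 0 < N \<Longrightarrow> real N * \<delta> = T \<Longrightarrow>
      \<delta>\<^sup>2 / (\<delta> powr (2 * H) * fgn_eigenvalue_bound H N) = K * \<delta> powr min 1 (2 * (1 - H))"
    using sigma2_hat_rate[OF H T] by blast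
  have bounds: "0 \<le> sigma2_hat H (T / real N) N z \<and>
      sigma2_hat H (T / real N) N z \<le> C\<^sup>2 * (K * (T / real N) powr min 1 (2 * (1 - H)))" if N: "0 < N" for N
  proof -
    have \<delta>: "0 < T / real N" using N T by simp
    have "\<bar>z ((real i + 1) * (T / real N)) - z (real i * (T / real N))\<bar> \<le> C * (T / real N)" if "i < N" for i
    proof -
      have "(real i + 1) * (T / real N) \<le> real N * (T / real N)"
        using that \<delta> by (intro mult_right_mono) auto
      then have "(real i + 1) * (T / real N) \<le> T" using N by simp
      then have "\<bar>z ((real i + 1) * (T / real N)) - z (real i * (T / real N))\<bar>
          \<le> C * ((real i + 1) * (T / real N) - real i * (T / real N))"
        using \<delta> T by (intro lip mult_right_mono) auto
      also have "(real i + 1) * (T / real N) - real i * (T / real N) = T / real N"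
        by (simp only: left_diff_distrib[symmetric]) simp
      finally show ?thesis .
    qed
    from sigma2_hat_le_of_increments[OF H \<delta> N this] show ?thesis
      using sigma2_hat_bounds(1)[OF H \<delta> N] K[OF \<delta> N] N by simp
  qed
  have "(\<lambda>N. (T / real N) powr min 1 (2 * (1 - H))) \<longlonglongrightarrow> 0"
    using H T by (intro tendsto_zero_powrI[OF lim_const_over_n tendsto_const]) auto
  then have lim: "(\<lambda>N. C\<^sup>2 * (K * (T / real N) powr min 1 (2 * (1 - H)))) \<longlonglongrightarrow> 0"
    by (intro tendsto_mult_right_zero)
  show ?thesis
    by (rule tendsto_sandwich[OF _ _ tendsto_const lim];
      rule eventually_mono[OF eventually_gt_at_top[of "0::nat"]]; use bounds in blast)
qed

section \<open>Mean square bounds and their limits\<close>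

text \<open>Stated with the nonnegative integral, the bound includes square integrability and is preserved by
almost sure limits through Fatou's lemma.\<close>
definition l2_bounded :: "'a measure \<Rightarrow> ('a \<Rightarrow> real) \<Rightarrow> real \<Rightarrow> bool" where
  "l2_bounded M Z C \<longleftrightarrow> Z \<in> borel_measurable M \<and> 0 \<le> C \<and> (\<integral>\<^sup>+\<omega>. ennreal ((Z \<omega>)\<^sup>2) \<partial>M) \<le> ennreal (C\<^sup>2)"

lemma l2_boundedD:
  assumes "l2_bounded M Z C"
  shows "Z \<in> borel_measurable M" "0 \<le> C" "(\<integral>\<^sup>+\<omega>. ennreal ((Z \<omega>)\<^sup>2) \<partial>M) \<le> ennreal (C\<^sup>2)"
  using assms by (auto simp: l2_bounded_def)

lemma l2_bounded_mono: "l2_bounded M Z C \<Longrightarrow> C \<le> D \<Longrightarrow> l2_bounded M Z D"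
  unfolding l2_bounded_def by (auto intro: order_trans ennreal_leI power_mono)

lemma l2_bounded_AE_cong:
  assumes "l2_bounded M Z C" "W \<in> borel_measurable M" "AE \<omega> in M. W \<omega> = Z \<omega>"
  shows "l2_bounded M W C"
proof -
  have "(\<integral>\<^sup>+\<omega>. ennreal ((W \<omega>)\<^sup>2) \<partial>M) = (\<integral>\<^sup>+\<omega>. ennreal ((Z \<omega>)\<^sup>2) \<partial>M)"
    using assms(3) by (intro nn_integral_cong_AE) auto
  with assms show ?thesis by (simp add: l2_bounded_def)
qed

lemma l2_bounded_cmult:
  assumes "l2_bounded M Z C"
  shows "l2_bounded M (\<lambda>\<omega>. c * Z \<omega>) (\<bar>c\<bar> * C)"
proof -
  note [measurable] = l2_boundedD(1)[OF assms]
  have "(\<integral>\<^sup>+\<omega>. ennreal ((c * Z \<omega>)\<^sup>2) \<partial>M) = ennreal (c\<^sup>2) * (\<integral>\<^sup>+\<omega>. ennreal ((Z \<omega>)\<^sup>2) \<partial>M)"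
    by (subst nn_integral_cmult[symmetric]) (auto simp: power_mult_distrib ennreal_mult)
  also have "\<dots> \<le> ennreal (c\<^sup>2) * ennreal (C\<^sup>2)"
    by (intro mult_left_mono l2_boundedD[OF assms]) auto
  also have "\<dots> = ennreal ((\<bar>c\<bar> * C)\<^sup>2)"
    by (simp add: power_mult_distrib ennreal_mult)
  finally show ?thesis using l2_boundedD(2)[OF assms] by (simp add: l2_bounded_def)
qed

lemma l2_bounded_0_AE:
  assumes "l2_bounded M Z 0"
  shows "AE \<omega> in M. Z \<omega> = 0"
proof -
  note [measurable] = l2_boundedD(1)[OF assms]
  have "(\<integral>\<^sup>+\<omega>. ennreal ((Z \<omega>)\<^sup>2) \<partial>M) = 0" using l2_boundedD(3)[OF assms] by simp
  then have "AE \<omega> in M. ennreal ((Z \<omega>)\<^sup>2) = 0" by (subst (asm) nn_integral_0_iff_AE) auto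
  then show ?thesis by eventually_elim (auto simp: ennreal_eq_0_iff)
qed

text \<open>Minkowski's inequality, from the pointwise bound \<open>(z + w)\<^sup>2 \<le> (C + D) * (z\<^sup>2 / C + w\<^sup>2 / D)\<close>, whose
weights are chosen so that the integrated right-hand side is exactly \<open>(C + D)\<^sup>2\<close>. If one of the bounds is 0,
the corresponding variable vanishes almost surely.\<close>
lemma l2_bounded_add:
  assumes Z: "l2_bounded M Z C" and W: "l2_bounded M W D"
  shows "l2_bounded M (\<lambda>\<omega>. Z \<omega> + W \<omega>) (C + D)"
proof -
  note [measurable] = l2_boundedD(1)[OF Z] l2_boundedD(1)[OF W]
  consider "C = 0" | "D = 0" | "0 < C" "0 < D"
    using l2_boundedD(2)[OF Z] l2_boundedD(2)[OF W] by linarith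
  then show ?thesis
  proof cases
    case 1
    with Z have "AE \<omega> in M. Z \<omega> = 0" by (auto intro: l2_bounded_0_AE)
    then have "AE \<omega> in M. Z \<omega> + W \<omega> = W \<omega>" by eventually_elim simp
    with 1 W show ?thesis by (auto intro: l2_bounded_AE_cong)
  next
    case 2
    with W have "AE \<omega> in M. W \<omega> = 0" by (auto intro: l2_bounded_0_AE)
    then have "AE \<omega> in M. Z \<omega> + W \<omega> = Z \<omega>" by eventually_elim simp
    with 2 Z show ?thesis by (auto intro: l2_bounded_AE_cong)
  next
    case 3
    have weighted: "(z + w)\<^sup>2 \<le> (C + D) / C * z\<^sup>2 + (C + D) / D * w\<^sup>2" for z w
    proof -
      have "0 \<le> (D * z - C * w)\<^sup>2 / (C * D)" using 3 by simp
      also have "\<dots> = (C + D) / C * z\<^sup>2 + (C + D) / D * w\<^sup>2 - (z + w)\<^sup>2"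
        using 3 by (simp add: field_simps power2_eq_square)
      finally show ?thesis by simp
    qed
    have "(\<integral>\<^sup>+\<omega>. ennreal ((Z \<omega> + W \<omega>)\<^sup>2) \<partial>M)
        \<le> (\<integral>\<^sup>+\<omega>. ennreal ((C + D) / C) * ennreal ((Z \<omega>)\<^sup>2) + ennreal ((C + D) / D) * ennreal ((W \<omega>)\<^sup>2) \<partial>M)"
      using 3 weighted
      by (intro nn_integral_mono) (simp add: ennreal_mult[symmetric] ennreal_plus[symmetric] del: ennreal_plus)
    also have "\<dots> = ennreal ((C + D) / C) * (\<integral>\<^sup>+\<omega>. ennreal ((Z \<omega>)\<^sup>2) \<partial>M)
        + ennreal ((C + D) / D) * (\<integral>\<^sup>+\<omega>. ennreal ((W \<omega>)\<^sup>2) \<partial>M)"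
      by (simp add: nn_integral_add nn_integral_cmult)
    also have "\<dots> \<le> ennreal ((C + D) / C) * ennreal (C\<^sup>2) + ennreal ((C + D) / D) * ennreal (D\<^sup>2)"
      by (intro add_mono mult_left_mono l2_boundedD[OF Z] l2_boundedD[OF W]) auto
    also have "\<dots> = ennreal ((C + D) / C * C\<^sup>2 + (C + D) / D * D\<^sup>2)"
      using 3 by (simp add: ennreal_mult[symmetric] ennreal_plus[symmetric] del: ennreal_plus)
    also have "(C + D) / C * C\<^sup>2 + (C + D) / D * D\<^sup>2 = (C + D)\<^sup>2"
      using 3 by (simp add: power2_eq_square field_simps)
    finally show ?thesis using 3 by (simp add: l2_bounded_def)
  qed
qed

lemma l2_bounded_sum:
  assumes "\<And>i. i < n \<Longrightarrow> l2_bounded M (Z i) (C i)"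
  shows "l2_bounded M (\<lambda>\<omega>. \<Sum>i<n. Z i \<omega>) (\<Sum>i<(n::nat). C i)"
  using assms
proof (induction n)
  case 0
  show ?case by (simp add: l2_bounded_def)
next
  case (Suc n)
  then show ?case by (auto intro!: l2_bounded_add)
qed

lemma l2_bounded_limit:
  assumes Z: "\<And>n. l2_bounded M (Z n) (C n)" and C: "C \<longlonglongrightarrow> D"
    and W: "W \<in> borel_measurable M" and lim: "AE \<omega> in M. (\<lambda>n. Z n \<omega>) \<longlonglongrightarrow> W \<omega>"
  shows "l2_bounded M W D"
proof -
  note [measurable] = l2_boundedD(1)[OF Z]
  have "AE \<omega> in M. ennreal ((W \<omega>)\<^sup>2) = liminf (\<lambda>n. ennreal ((Z n \<omega>)\<^sup>2))"
    using lim
  proof eventually_elim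
    case (elim \<omega>)
    then have "(\<lambda>n. ennreal ((Z n \<omega>)\<^sup>2)) \<longlonglongrightarrow> ennreal ((W \<omega>)\<^sup>2)"
      by (intro tendsto_ennrealI tendsto_power)
    then show ?case by (metis lim_imp_Liminf sequentially_bot)
  qed
  then have "(\<integral>\<^sup>+\<omega>. ennreal ((W \<omega>)\<^sup>2) \<partial>M) = (\<integral>\<^sup>+\<omega>. liminf (\<lambda>n. ennreal ((Z n \<omega>)\<^sup>2)) \<partial>M)"
    by (rule nn_integral_cong_AE)
  also have "\<dots> \<le> liminf (\<lambda>n. \<integral>\<^sup>+\<omega>. ennreal ((Z n \<omega>)\<^sup>2) \<partial>M)"
    by (rule nn_integral_liminf) auto
  also have "\<dots> \<le> liminf (\<lambda>n. ennreal ((C n)\<^sup>2))"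
    by (intro Liminf_mono always_eventually allI l2_boundedD[OF Z])
  also have "\<dots> = ennreal (D\<^sup>2)"
    by (intro lim_imp_Liminf tendsto_ennrealI tendsto_power C) simp
  finally show ?thesis using W LIMSEQ_le_const[OF C] l2_boundedD(2)[OF Z]
    by (auto simp: l2_bounded_def)
qed

lemma l2_bounded_integrable:
  assumes "l2_bounded M Z C"
  shows "integrable M (\<lambda>\<omega>. (Z \<omega>)\<^sup>2)" and "(\<integral>\<omega>. (Z \<omega>)\<^sup>2 \<partial>M) \<le> C\<^sup>2"
proof -
  note [measurable] = l2_boundedD(1)[OF assms]
  show int: "integrable M (\<lambda>\<omega>. (Z \<omega>)\<^sup>2)"
    using le_less_trans[OF l2_boundedD(3)[OF assms]] by (intro integrableI_nonneg) auto
  show "(\<integral>\<omega>. (Z \<omega>)\<^sup>2 \<partial>M) \<le> C\<^sup>2"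
    using l2_boundedD(3)[OF assms] nn_integral_eq_integral[OF int] by simp
qed

text \<open>There are \<open>Suc n\<close> cells, so the mesh never involves a division by zero.\<close>
definition grid :: "real \<Rightarrow> real \<Rightarrow> nat \<Rightarrow> nat \<Rightarrow> real" where
  "grid a b n k = a + real k * ((b - a) / real (Suc n))"

lemma grid_simps [simp]: "grid a b n 0 = a" "grid a b n (Suc n) = b"
  by (auto simp: grid_def)

lemma grid_step: "grid a b n (Suc k) = grid a b n k + (b - a) / real (Suc n)"
  
proof -
  have "real (Suc k) * h = real k * h + h" for h :: real by (simp add: distrib_right)
  then show ?thesis unfolding grid_def by (metis add.assoc)
qed

lemma grid_mono: "a \<le> b \<Longrightarrow> j \<le> k \<Longrightarrow> grid a b n j \<le> grid a b n k"
  unfolding grid_def by (intro add_left_mono mult_right_mono divide_nonneg_nonneg) simp_all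

lemma grid_mem: "a \<le> b \<Longrightarrow> k \<le> Suc n \<Longrightarrow> grid a b n k \<in> {a..b}"
  using grid_mono[of a b 0 k n] grid_mono[of a b k "Suc n" n] by simp

lemma UN_consecutive_intervals:
  fixes s :: "nat \<Rightarrow> real"
  assumes "\<And>k. s k \<le> s (Suc k)"
  shows "(\<Union>k<Suc n. {s k..s (Suc k)}) = {s 0..s (Suc n)}"
proof (induction n)
  case (Suc n)
  have "s 0 \<le> s (Suc n)" by (rule lift_Suc_mono_le[of s]) (simp_all add: assms)
  then have "{s 0..s (Suc n)} \<union> {s (Suc n)..s (Suc (Suc n))} = {s 0..s (Suc (Suc n))}"
    using assms[of "Suc n"] by auto
  then show ?case using Suc by (simp add: lessThan_Suc Un_commute)
qed (simp add: lessThan_Suc)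

lemma grid_tagged_division:
  assumes "a < b"
  shows "(\<lambda>k. (grid a b n k, {grid a b n k..grid a b n (Suc k)})) ` {..<Suc n}
    tagged_division_of {a..b}" (is "?f ` _ tagged_division_of _")
proof (rule tagged_division_ofI)
  let ?s = "grid a b n"
  have mono: "?s j \<le> ?s k" if "j \<le> k" for j k
    using assms that by (intro grid_mono) simp_all
  have mem: "?s k \<in> {a..b}" if "k \<le> Suc n" for k
    using assms that by (intro grid_mem) simp_all
  show "finite (?f ` {..<Suc n})" by simp
  fix x K assume "(x, K) \<in> ?f ` {..<Suc n}"
  then obtain k where k: "k < Suc n" "x = ?s k" "K = {?s k..?s (Suc k)}" by auto
  show "x \<in> K" using k mono[of k "Suc k"] by simp
  show "K \<subseteq> {a..b}" using k mem[of k] mem[of "Suc k"] by auto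
  show "\<exists>u v. K = cbox u v" using k by auto
  fix y L assume "(y, L) \<in> ?f ` {..<Suc n}" "(x, K) \<noteq> (y, L)"
  then obtain l where l: "l < Suc n" "y = ?s l" "L = {?s l..?s (Suc l)}" by auto
  with \<open>(x, K) \<noteq> (y, L)\<close> k have "k \<noteq> l" by auto
  then consider "Suc k \<le> l" | "Suc l \<le> k" by linarith
  then show "interior K \<inter> interior L = {}"
    using mono[of "Suc k" l] mono[of "Suc l" k]
    by cases (simp_all only: k(3) l(3) interior_atLeastAtMost_real, auto)
next
  have "{K. \<exists>x. (x, K) \<in> ?f ` {..<Suc n}} = (\<lambda>k. {grid a b n k..grid a b n (Suc k)}) ` {..<Suc n}"
    by blast
  then have "\<Union>{K. \<exists>x. (x, K) \<in> ?f ` {..<Suc n}} = (\<Union>k<Suc n. {grid a b n k..grid a b n (Suc k)})"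
    by simp
  also have "\<dots> = {a..b}"
    using assms by (subst UN_consecutive_intervals) (simp_all add: grid_mono)
  finally show "\<Union>{K. \<exists>x. (x, K) \<in> ?f ` {..<Suc n}} = {a..b}" .
qed

lemma has_rs_integral_grid_sums:
  assumes I: "has_rs_integral f g a b I" and ab: "a < b"
  shows "(\<lambda>n. \<Sum>k<Suc n. f (grid a b n k) * (g (grid a b n (Suc k)) - g (grid a b n k))) \<longlonglongrightarrow> I"
proof (rule LIMSEQ_I)
  fix e :: real assume "0 < e"
  with I obtain d where d: "0 < d" and fine: "\<forall>p. p tagged_division_of {a..b} \<and> (\<forall>(x, K)\<in>p. diameter K < d) \<longrightarrow>
      \<bar>(\<Sum>(x, K)\<in>p. f x * (g (Sup K) - g (Inf K))) - I\<bar> < e"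
    unfolding has_rs_integral_def by blast
  have "(\<lambda>n. (b - a) / real (Suc n)) \<longlonglongrightarrow> 0"
    by (rule LIMSEQ_Suc[OF lim_const_over_n])
  then have "eventually (\<lambda>n. (b - a) / real (Suc n) < d) sequentially"
    using d by (rule order_tendstoD)
  then obtain n0 where n0: "\<And>n. n \<ge> n0 \<Longrightarrow> (b - a) / real (Suc n) < d"
    by (auto simp: eventually_sequentially)
  show "\<exists>no. \<forall>n\<ge>no. norm ((\<Sum>k<Suc n. f (grid a b n k) *
      (g (grid a b n (Suc k)) - g (grid a b n k))) - I) < e"
  proof (intro exI[of _ n0] allI impI)
    fix n assume n: "n \<ge> n0"
    let ?s = "grid a b n"
    let ?f = "\<lambda>k. (?s k, {?s k..?s (Suc k)})"
    have lt: "?s k < ?s (Suc k)" for k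
      using ab by (simp add: grid_step)
    then have "strict_mono ?s" by (simp add: strict_mono_Suc_iff)
    then have inj: "inj_on ?f {..<Suc n}"
      by (intro inj_onI) (simp add: strict_mono_eq)
    have "\<forall>(x, K)\<in>?f ` {..<Suc n}. diameter K < d"
    proof safe
      fix k
      have "diameter {?s k..?s (Suc k)} = (b - a) / real (Suc n)"
        using lt[of k] by (simp add: diameter_closed_interval grid_step)
      then show "diameter {?s k..?s (Suc k)} < d" using n0[OF n] by simp
    qed
    with fine grid_tagged_division[OF ab, of n]
    have "\<bar>(\<Sum>(x, K)\<in>?f ` {..<Suc n}. f x * (g (Sup K) - g (Inf K))) - I\<bar> < e" by blast
    then have "\<bar>(\<Sum>k<Suc n. f (?s k) * (g (Sup {?s k..?s (Suc k)}) - g (Inf {?s k..?s (Suc k)}))) - I\<bar> < e"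
      by (subst (asm) sum.reindex[OF inj]) (simp add: o_def)
    then show "norm ((\<Sum>k<Suc n. f (?s k) * (g (?s (Suc k)) - g (?s k))) - I) < e"
      using lt by (simp add: less_imp_le)
  qed
qed

text \<open>The error in each cell is the integral of the deviation of \<open>f\<close> from its value at the left end point, which uniform continuity
makes small relative to the length of the cell.\<close>
lemma riemann_sums_tendsto_integral:
  fixes f :: "real \<Rightarrow> real"
  assumes cont: "continuous_on {a..b} f" and ab: "a < b"
  shows "(\<lambda>n. \<Sum>k<Suc n. (b - a) / real (Suc n) * f (grid a b n k)) \<longlonglongrightarrow> integral {a..b} f"
proof (rule LIMSEQ_I)
  fix e :: real assume "0 < e"
  define e' where "e' = e / (2 * (b - a))"
  have e': "0 < e'" using \<open>0 < e\<close> ab by (simp add: e'_def)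
  have "uniformly_continuous_on {a..b} f"
    using cont by (intro compact_uniformly_continuous) auto
  then obtain d where d: "0 < d"
    and *: "\<And>x y. x \<in> {a..b} \<Longrightarrow> y \<in> {a..b} \<Longrightarrow> dist y x < d \<Longrightarrow> dist (f y) (f x) < e'"
    using e' unfolding uniformly_continuous_on_def by metis
  have "(\<lambda>n. (b - a) / real (Suc n)) \<longlonglongrightarrow> 0"
    by (rule LIMSEQ_Suc[OF lim_const_over_n])
  then have "eventually (\<lambda>n. (b - a) / real (Suc n) < d) sequentially"
    using d by (rule order_tendstoD)
  then obtain n0 where n0: "\<And>n. n \<ge> n0 \<Longrightarrow> (b - a) / real (Suc n) < d"
    by (auto simp: eventually_sequentially)
  show "\<exists>no. \<forall>n\<ge>no. norm ((\<Sum>k<Suc n. (b - a) / real (Suc n) * f (grid a b n k)) - integral {a..b} f) < e"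
  proof (intro exI[of _ n0] allI impI)
    fix n assume n: "n \<ge> n0"
    define h where "h = (b - a) / real (Suc n)"
    have h: "0 < h" "h < d" using ab n0[OF n] by (auto simp: h_def)
    let ?s = "grid a b n"
    define F where "F x = integral {a..x} f" for x
    have step: "?s (Suc k) = ?s k + h" for k by (simp add: grid_step h_def)
    have int: "f integrable_on {u..v}" if "a \<le> u" "v \<le> b" for u v
      using that cont by (intro integrable_continuous_interval) (auto elim: continuous_on_subset)
    have "\<bar>h * f (?s k) - (F (?s (Suc k)) - F (?s k))\<bar> \<le> e' * h" if k: "k < Suc n" for k
    proof -
      have mem: "?s k \<in> {a..b}" "?s (Suc k) \<in> {a..b}" using grid_mem ab k by auto
      have "integral {a..?s k} f + integral {?s k..?s (Suc k)} f = integral {a..?s (Suc k)} f"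
        using mem step[of k] h by (intro Henstock_Kurzweil_Integration.integral_combine int) auto
      then have "F (?s (Suc k)) - F (?s k) = integral {?s k..?s (Suc k)} f" by (simp add: F_def)
      moreover have "h * f (?s k) = integral {?s k..?s (Suc k)} (\<lambda>_. f (?s k))"
        using h step[of k] by simp
      ultimately have "h * f (?s k) - (F (?s (Suc k)) - F (?s k)) =
          integral {?s k..?s (Suc k)} (\<lambda>x. f (?s k) - f x)"
        using mem by (subst Henstock_Kurzweil_Integration.integral_diff) (auto intro!: int)
      also have "norm \<dots> \<le> e' * (?s (Suc k) - ?s k)"
      proof (rule integral_bound)
        show "?s k \<le> ?s (Suc k)" using step[of k] h by simp
        show "continuous_on {?s k..?s (Suc k)} (\<lambda>x. f (?s k) - f x)"
          using mem by (intro continuous_intros continuous_on_subset[OF cont]) auto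
        fix x assume x: "x \<in> {?s k..?s (Suc k)}"
        have "dist (f (?s k)) (f x) < e'"
          using x mem step[of k] h by (intro *) (auto simp: dist_real_def)
        then show "norm (f (?s k) - f x) \<le> e'" by (simp add: dist_real_def)
      qed
      finally show ?thesis using step[of k] by simp
    qed
    then have "(\<Sum>k<Suc n. \<bar>h * f (?s k) - (F (?s (Suc k)) - F (?s k))\<bar>) \<le> (\<Sum>k<Suc n. e' * h)"
      by (intro sum_mono) auto
    then have "\<bar>\<Sum>k<Suc n. h * f (?s k) - (F (?s (Suc k)) - F (?s k))\<bar> \<le> (\<Sum>k<Suc n. e' * h)"
      by (rule order_trans[OF sum_abs])
    also have "\<dots> = e' * (b - a)" by (simp add: h_def del: of_nat_Suc)
    also have "e' * (b - a) = e / 2" using ab by (simp add: e'_def field_simps)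
    also have "\<dots> < e" using \<open>0 < e\<close> by simp
    also have "(\<Sum>k<Suc n. h * f (?s k) - (F (?s (Suc k)) - F (?s k))) =
        (\<Sum>k<Suc n. h * f (?s k)) - (F b - F a)"
      by (subst sum_subtractf, subst sum_lessThan_telescope[of "\<lambda>k. F (?s k)"]) simp
    also have "F b - F a = integral {a..b} f" by (simp add: F_def)
    finally show "norm ((\<Sum>k<Suc n. (b - a) / real (Suc n) * f (?s k)) - integral {a..b} f) < e"
      by (simp add: h_def)
  qed
qed

text \<open>Minkowski's inequality for integrals: the norms of the Riemann sums of the paths are bounded by the Riemann sums of
\<open>\<phi>\<close>, and both sides converge.\<close>
lemma l2_bounded_integral:
  fixes Z :: "real \<Rightarrow> 'a \<Rightarrow> real"
  assumes ab: "a \<le> b" and Z: "\<And>s. s \<in> {a..b} \<Longrightarrow> l2_bounded M (Z s) (\<phi> s)"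
    and cont: "AE \<omega> in M. continuous_on {a..b} (\<lambda>s. Z s \<omega>)" and \<phi>: "continuous_on {a..b} \<phi>"
    and W: "W \<in> borel_measurable M" and eq: "AE \<omega> in M. W \<omega> = integral {a..b} (\<lambda>s. Z s \<omega>)"
  shows "l2_bounded M W (integral {a..b} \<phi>)"
proof (cases "a = b")
  case True
  then have "AE \<omega> in M. W \<omega> = 0" using eq by simp
  moreover have "l2_bounded M (\<lambda>_. 0) 0" by (simp add: l2_bounded_def)
  ultimately show ?thesis using W True by (auto intro: l2_bounded_AE_cong)
next
  case False
  with ab have lt: "a < b" by simp
  show ?thesis
  proof (rule l2_bounded_limit[OF _ riemann_sums_tendsto_integral[OF \<phi> lt] W])
    fix n
    have "l2_bounded M (\<lambda>\<omega>. (b - a) / real (Suc n) * Z (grid a b n k) \<omega>)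
        ((b - a) / real (Suc n) * \<phi> (grid a b n k))" if "k < Suc n" for k
      using l2_bounded_cmult[OF Z[OF grid_mem[OF ab]], of k n "(b - a) / real (Suc n)"] that ab by simp
    then show "l2_bounded M (\<lambda>\<omega>. \<Sum>k<Suc n. (b - a) / real (Suc n) * Z (grid a b n k) \<omega>)
        (\<Sum>k<Suc n. (b - a) / real (Suc n) * \<phi> (grid a b n k))"
      by (rule l2_bounded_sum)
  next
    show "AE \<omega> in M. (\<lambda>n. \<Sum>k<Suc n. (b - a) / real (Suc n) * Z (grid a b n k) \<omega>) \<longlonglongrightarrow> W \<omega>"
      using cont eq
    proof eventually_elim
      case (elim \<omega>)
      show ?case using riemann_sums_tendsto_integral[OF elim(1) lt] elim(2) by simp
    qed
  qed
qed

lemma abel_summation: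
  fixes f w :: "nat \<Rightarrow> real"
  shows "(\<Sum>k<Suc n. f k * (w (Suc k) - w k)) =
    f n * w (Suc n) - f 0 * w 0 - (\<Sum>k<n. (f (Suc k) - f k) * w (Suc k))"
  by (induction n) (auto simp: algebra_simps)

text \<open>This inequality trades half of the exponential rate \<open>1 / \<epsilon>\<close> for the growth \<open>u powr H\<close> of the increments of the noise, at the
scale \<open>\<epsilon> powr H\<close>. It follows from \<open>v powr H \<le> max 1 v \<le> exp v\<close> at \<open>v = u / (2 * \<epsilon>)\<close>.\<close>
lemma powr_le_scaled_exp:
  fixes \<epsilon> u H :: real
  assumes "0 < \<epsilon>" "0 \<le> u" "0 < H" "H < 1"
  shows "u powr H \<le> 2 * \<epsilon> powr H * exp (u / (2 * \<epsilon>))"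
proof -
  define v where "v = u / (2 * \<epsilon>)"
  have v: "0 \<le> v" using assms by (simp add: v_def)
  have "v powr H \<le> exp v"
  proof (cases "v \<le> 1")
    case True
    then have "v powr H \<le> 1" using v assms by (intro powr_le1) auto
    also have "1 \<le> exp v" using v by simp
    finally show ?thesis .
  next
    case False
    then have "v powr H \<le> v powr 1" using assms by (intro powr_mono) auto
    also have "\<dots> = v" using False by simp
    also have "\<dots> \<le> exp v" using exp_ge_add_one_self[of v] by linarith
    finally show ?thesis .
  qed
  have two: "(2::real) powr H \<le> 2" using powr_mono[of H 1 "2::real"] assms by simp
  have "u powr H = 2 powr H * \<epsilon> powr H * v powr H"
    using assms v by (simp add: powr_mult[symmetric] v_def)
  also have "\<dots> \<le> 2 * \<epsilon> powr H * exp v"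
    using two \<open>v powr H \<le> exp v\<close> by (intro mult_mono) auto
  finally show ?thesis by (simp add: v_def)
qed

section \<open>The fractional Ornstein-Uhlenbeck process in mean square\<close>
lemma (in prob_space) gaussian_rv_square_integrable:
  assumes "gaussian_rv M Z"
  shows "integrable M (\<lambda>\<omega>. (Z \<omega>)\<^sup>2)"
proof -
  have [measurable]: "Z \<in> borel_measurable M" using assms by (simp add: gaussian_rv_def)
  consider \<mu> \<sigma> where "0 < \<sigma>" "distributed M lborel Z (\<lambda>x. ennreal (normal_density \<mu> \<sigma> x))"
    | \<mu> where "AE \<omega> in M. Z \<omega> = \<mu>"
    using assms unfolding gaussian_rv_def by blast
  then show ?thesis
  proof cases
    case 1
    have "integrable lborel (\<lambda>x. normal_density \<mu> \<sigma> x * (x - \<mu>)\<^sup>2)"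
      "integrable lborel (\<lambda>x. normal_density \<mu> \<sigma> x * x)"
      "integrable lborel (\<lambda>x. normal_density \<mu> \<sigma> x)"
      using integrable_normal_moment[OF 1(1), of \<mu> 2] integrable_normal_moment_nz_1[OF 1(1)]
        integrable_normal_moment[OF 1(1), of \<mu> 0] by auto
    then have "integrable lborel (\<lambda>x. normal_density \<mu> \<sigma> x * (x - \<mu>)\<^sup>2
        + 2 * \<mu> * (normal_density \<mu> \<sigma> x * x) - \<mu>\<^sup>2 * normal_density \<mu> \<sigma> x)"
      by (intro Bochner_Integration.integrable_add Bochner_Integration.integrable_diff integrable_mult_right)
    also have "(\<lambda>x. normal_density \<mu> \<sigma> x * (x - \<mu>)\<^sup>2
        + 2 * \<mu> * (normal_density \<mu> \<sigma> x * x) - \<mu>\<^sup>2 * normal_density \<mu> \<sigma> x) =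
        (\<lambda>x. normal_density \<mu> \<sigma> x * x\<^sup>2)"
      by (simp add: fun_eq_iff power2_eq_square algebra_simps)
    finally show ?thesis
      using distributed_integrable[OF 1(2), of "\<lambda>x. x\<^sup>2"] by simp
  next
    case 2
    then have "AE \<omega> in M. (Z \<omega>)\<^sup>2 = \<mu>\<^sup>2" by eventually_elim simp
    then have "integrable M (\<lambda>\<omega>. (Z \<omega>)\<^sup>2) \<longleftrightarrow> integrable M (\<lambda>_. \<mu>\<^sup>2)"
      by (intro integrable_cong_AE) auto
    then show ?thesis by simp
  qed
qed

lemma gaussian_process_rv:
  assumes "gaussian_process M B"
  shows "gaussian_rv M (B t)"
proof -
  have "gaussian_rv M (\<lambda>\<omega>. \<Sum>s\<in>{t}. 1 * B s \<omega>)"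
    using assms[unfolded gaussian_process_def, rule_format, of "{t}" "\<lambda>_. 1"] by simp
  then show ?thesis by simp
qed

text \<open>The covariance function determines the second moment of an increment only when the products are
integrable, since the integral of a function that is not integrable has the default value 0. The Gaussian assumption provides
this.\<close>
lemma (in prob_space) fbm_increment_l2:
  assumes "fractional_brownian_motion M H B"
  shows "l2_bounded M (\<lambda>\<omega>. B t \<omega> - B s \<omega>) (\<bar>t - s\<bar> powr H)"
proof -
  have g: "gaussian_rv M (B t)" for t
    using assms by (intro gaussian_process_rv) (simp add: fractional_brownian_motion_def)
  then have [measurable]: "B t \<in> borel_measurable M" for t by (simp add: gaussian_rv_def)
  have sq: "integrable M (\<lambda>\<omega>. (B t \<omega>)\<^sup>2)" for t
    by (rule gaussian_rv_square_integrable[OF g])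
  have prod: "integrable M (\<lambda>\<omega>. B t \<omega> * B s \<omega>)"
  proof (rule Bochner_Integration.integrable_bound[OF Bochner_Integration.integrable_add[OF sq[of t] sq[of s]]])
    have "\<bar>x * y\<bar> \<le> x\<^sup>2 + y\<^sup>2" for x y :: real
    proof -
      have "0 \<le> \<bar>x\<bar> * \<bar>y\<bar>" by simp
      then show ?thesis using sum_squares_bound[of "\<bar>x\<bar>" "\<bar>y\<bar>"]
        unfolding power2_abs abs_mult by linarith
    qed
    then show "AE \<omega> in M. norm (B t \<omega> * B s \<omega>) \<le> norm ((B t \<omega>)\<^sup>2 + (B s \<omega>)\<^sup>2)"
      by (auto intro!: AE_I2 order_trans[OF _ abs_ge_self])
  qed measurable
  have cov: "(\<integral>\<omega>. B u \<omega> * B v \<omega> \<partial>M) = (\<bar>u\<bar> powr (2 * H) + \<bar>v\<bar> powr (2 * H) - \<bar>u - v\<bar> powr (2 * H)) / 2" for u v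
    using assms by (simp add: fractional_brownian_motion_def)
  have expand: "(B t \<omega> - B s \<omega>)\<^sup>2 = (B t \<omega>)\<^sup>2 + (B s \<omega>)\<^sup>2 - 2 * (B t \<omega> * B s \<omega>)" for \<omega>
    by (simp add: power2_diff)
  have int: "integrable M (\<lambda>\<omega>. (B t \<omega> - B s \<omega>)\<^sup>2)"
    unfolding expand using sq prod by auto
  have "(\<integral>\<omega>. (B t \<omega> - B s \<omega>)\<^sup>2 \<partial>M) =
      (\<integral>\<omega>. (B t \<omega>)\<^sup>2 \<partial>M) + (\<integral>\<omega>. (B s \<omega>)\<^sup>2 \<partial>M) - 2 * (\<integral>\<omega>. B t \<omega> * B s \<omega> \<partial>M)"
    unfolding expand using sq prod by simp
  also have "\<dots> = \<bar>t - s\<bar> powr (2 * H)"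
    using cov[of t t] cov[of s s] cov[of t s] by (simp add: power2_eq_square)
  also have "\<dots> = (\<bar>t - s\<bar> powr H)\<^sup>2"
    by (simp only: mult_2 powr_add power2_eq_square)
  finally show ?thesis
    using nn_integral_eq_integral[OF int] by (simp add: l2_bounded_def)
qed

text \<open>Summation by parts moves the differences from the noise to the weight. With \<open>q = sqrt f\<close> the increments
of the weight satisfy \<open>f (k + 1) - f k \<le> 2 * q (k + 1) * (q (k + 1) - q k)\<close>. One factor \<open>q\<close> absorbs the growth of
the noise, and the sum of the differences of \<open>q\<close> telescopes to at most 1. The resulting bound depends neither on the mesh
nor on the left end point.\<close>
lemma wiener_grid_sum_l2:
  assumes fbm: "\<And>s t. l2_bounded M (\<lambda>\<omega>. B t \<omega> - B s \<omega>) (\<bar>t - s\<bar> powr H)"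
    and \<epsilon>: "0 < \<epsilon>" and H: "0 < H" "H < 1" and a: "a < 0"
  shows "l2_bounded M (\<lambda>\<omega>. \<Sum>k<Suc n. exp (grid a 0 n k / \<epsilon>) * (B (grid a 0 n (Suc k)) \<omega> - B (grid a 0 n k) \<omega>))
    (6 * \<epsilon> powr H)"
proof -
  define f where "f k = exp (grid a 0 n k / \<epsilon>)" for k
  define q where "q k = exp (grid a 0 n k / (2 * \<epsilon>))" for k
  define u where "u k = \<bar>grid a 0 n k - 0\<bar> powr H" for k
  have fq: "f k = q k * q k" for k
    by (simp add: f_def q_def exp_add[symmetric] field_simps)
  have q_mono: "q j \<le> q k" if "j \<le> k" for j k
    using grid_mono[OF less_imp_le[OF a] that] \<epsilon> by (simp add: q_def divide_right_mono)
  have q_pos: "0 < q k" for k by (simp add: q_def)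
  have q_le: "q k \<le> 1" if "k \<le> Suc n" for k
    using q_mono[OF that] by (simp add: q_def)
  have qu: "q k * u k \<le> 2 * \<epsilon> powr H" if "k \<le> Suc n" for k
  proof -
    have neg: "grid a 0 n k \<le> 0" using grid_mem[of a 0 k n] a that by simp
    have "u k \<le> 2 * \<epsilon> powr H * exp (- grid a 0 n k / (2 * \<epsilon>))"
      using powr_le_scaled_exp[OF \<epsilon> _ H, of "- grid a 0 n k"] neg by (simp add: u_def)
    then have "q k * u k \<le> q k * (2 * \<epsilon> powr H * exp (- grid a 0 n k / (2 * \<epsilon>)))"
      using q_pos by (intro mult_left_mono) (auto simp: less_imp_le)
    also have "\<dots> = 2 * \<epsilon> powr H" by (simp add: q_def exp_minus)
    finally show ?thesis .
  qed
  have sum_eq: "(\<Sum>k<Suc n. f k * (B (grid a 0 n (Suc k)) \<omega> - B (grid a 0 n k) \<omega>)) =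
      - f 0 * (B (grid a 0 n 0) \<omega> - B 0 \<omega>)
      + (\<Sum>k<n. (f k - f (Suc k)) * (B (grid a 0 n (Suc k)) \<omega> - B 0 \<omega>))" for \<omega>
  proof -
    have "(\<Sum>k<n. (f k - f (Suc k)) * w k) = - (\<Sum>k<n. (f (Suc k) - f k) * w k)" for w
      by (simp only: sum_negf[symmetric] minus_mult_left minus_diff_eq)
    then show ?thesis using abel_summation[of f "\<lambda>k. B (grid a 0 n k) \<omega> - B 0 \<omega>" n]
      by (simp del: sum.lessThan_Suc)
  qed
  have "l2_bounded M (\<lambda>\<omega>. - f 0 * (B (grid a 0 n 0) \<omega> - B 0 \<omega>)
      + (\<Sum>k<n. (f k - f (Suc k)) * (B (grid a 0 n (Suc k)) \<omega> - B 0 \<omega>)))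
      (\<bar>- f 0\<bar> * u 0 + (\<Sum>k<n. \<bar>f k - f (Suc k)\<bar> * u (Suc k)))"
    unfolding u_def by (intro l2_bounded_add l2_bounded_sum l2_bounded_cmult fbm)
  moreover have "\<bar>- f 0\<bar> * u 0 + (\<Sum>k<n. \<bar>f k - f (Suc k)\<bar> * u (Suc k)) \<le> 6 * \<epsilon> powr H"
  proof -
    have "\<bar>- f 0\<bar> * u 0 = q 0 * (q 0 * u 0)" by (simp add: fq)
    also have "\<dots> \<le> 1 * (2 * \<epsilon> powr H)"
      using q_pos[of 0] q_le[of 0] qu[of 0] by (intro mult_mono[of "q 0" 1 "q 0 * u 0"]) (auto simp: u_def)
    finally have first: "\<bar>- f 0\<bar> * u 0 \<le> 2 * \<epsilon> powr H" by simp
    have "\<bar>f k - f (Suc k)\<bar> * u (Suc k) \<le> (q (Suc k) - q k) * (4 * \<epsilon> powr H)" if "k < n" for k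
    proof -
      have "\<bar>f k - f (Suc k)\<bar> = (q (Suc k) - q k) * (q (Suc k) + q k)"
        using mult_mono[OF q_mono[of k "Suc k"] q_mono[of k "Suc k"]] q_pos[of k] q_pos[of "Suc k"]
        by (simp add: fq abs_if algebra_simps)
      also have "\<dots> \<le> (q (Suc k) - q k) * (2 * q (Suc k))"
        using q_mono[of k "Suc k"] by (intro mult_left_mono) auto
      finally have "\<bar>f k - f (Suc k)\<bar> * u (Suc k) \<le> (q (Suc k) - q k) * (2 * q (Suc k)) * u (Suc k)"
        by (intro mult_right_mono) (auto simp: u_def)
      also have "\<dots> = (q (Suc k) - q k) * (2 * (q (Suc k) * u (Suc k)))" by simp
      also have "\<dots> \<le> (q (Suc k) - q k) * (4 * \<epsilon> powr H)"
        using q_mono[of k "Suc k"] qu[of "Suc k"] that by (intro mult_left_mono) auto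
      finally show ?thesis .
    qed
    then have "(\<Sum>k<n. \<bar>f k - f (Suc k)\<bar> * u (Suc k)) \<le> (\<Sum>k<n. (q (Suc k) - q k) * (4 * \<epsilon> powr H))"
      by (intro sum_mono) auto
    also have "\<dots> = (q n - q 0) * (4 * \<epsilon> powr H)"
      by (simp only: sum_distrib_right[symmetric] sum_lessThan_telescope)
    also have "\<dots> \<le> 1 * (4 * \<epsilon> powr H)"
      using q_le[of n] q_pos[of 0] by (intro mult_right_mono) auto
    finally show ?thesis using first by simp
  qed
  ultimately have "l2_bounded M (\<lambda>\<omega>. - f 0 * (B (grid a 0 n 0) \<omega> - B 0 \<omega>)
      + (\<Sum>k<n. (f k - f (Suc k)) * (B (grid a 0 n (Suc k)) \<omega> - B 0 \<omega>))) (6 * \<epsilon> powr H)"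
    by (rule l2_bounded_mono)
  then show ?thesis unfolding sum_eq[symmetric] unfolding f_def .
qed

text \<open>The improper integral is an iterated limit, in the mesh first and then in the left end point. The inner
limit is replaced by the measurable function \<open>L m\<close>, so that the bound passes through both limits.\<close>
lemma stationary_integral_l2:
  assumes fbm: "\<And>s t. l2_bounded M (\<lambda>\<omega>. B t \<omega> - B s \<omega>) (\<bar>t - s\<bar> powr H)"
    and \<epsilon>: "0 < \<epsilon>" and H: "0 < H" "H < 1"
    and V: "V \<in> borel_measurable M"
    and eq: "AE \<omega> in M. \<exists>I. has_improper_rs_integral (\<lambda>s. exp (s / \<epsilon>)) (\<lambda>s. B s \<omega>) 0 I \<and> V \<omega> = c * I"
  shows "l2_bounded M V (6 * \<bar>c\<bar> * \<epsilon> powr H)"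
proof -
  define S where "S m n \<omega> = (\<Sum>k<Suc n. exp (grid (- real (Suc m)) 0 n k / \<epsilon>) *
      (B (grid (- real (Suc m)) 0 n (Suc k)) \<omega> - B (grid (- real (Suc m)) 0 n k) \<omega>))" for m n \<omega>
  have S: "l2_bounded M (S m n) (6 * \<epsilon> powr H)" for m n
    unfolding S_def using wiener_grid_sum_l2[OF fbm \<epsilon> H, of "- real (Suc m)" n] by simp
  note [measurable] = l2_boundedD(1)[OF S]
  define L where "L m \<omega> = lim (\<lambda>n. S m n \<omega>)" for m \<omega>
  have L_meas: "L m \<in> borel_measurable M" for m unfolding L_def by measurable
  have conv: "AE \<omega> in M. (\<forall>m. (\<lambda>n. S m n \<omega>) \<longlonglongrightarrow> L m \<omega>) \<and> (\<lambda>m. c * L m \<omega>) \<longlonglongrightarrow> V \<omega>"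
    using eq
  proof eventually_elim
    case (elim \<omega>)
    then obtain I J where J: "\<And>a. a \<le> 0 \<Longrightarrow> has_rs_integral (\<lambda>s. exp (s / \<epsilon>)) (\<lambda>s. B s \<omega>) a 0 (J a)"
      and I: "(J \<longlongrightarrow> I) at_bot" and VI: "V \<omega> = c * I"
      unfolding has_improper_rs_integral_def by blast
    have lim: "(\<lambda>n. S m n \<omega>) \<longlonglongrightarrow> J (- real (Suc m))" for m
      unfolding S_def by (rule has_rs_integral_grid_sums[OF J]) auto
    then have LJ: "L m \<omega> = J (- real (Suc m))" for m
      unfolding L_def by (rule limI)
    have "filterlim (\<lambda>m. - real (Suc m)) at_bot sequentially"
      by (simp only: filterlim_uminus_at_bot minus_minus)
        (rule filterlim_compose[OF filterlim_real_sequentially filterlim_Suc])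
    then have "(\<lambda>m. J (- real (Suc m))) \<longlonglongrightarrow> I"
      by (rule filterlim_compose[OF I])
    then show ?case using lim unfolding LJ VI by (simp add: tendsto_mult_left)
  qed
  have "l2_bounded M (L m) (6 * \<epsilon> powr H)" for m
  proof (rule l2_bounded_limit[OF S tendsto_const L_meas])
    show "AE \<omega> in M. (\<lambda>n. S m n \<omega>) \<longlonglongrightarrow> L m \<omega>"
      using conv by eventually_elim blast
  qed
  then have "l2_bounded M (\<lambda>\<omega>. c * L m \<omega>) (\<bar>c\<bar> * (6 * \<epsilon> powr H))" for m
    by (rule l2_bounded_cmult)
  then have "l2_bounded M V (\<bar>c\<bar> * (6 * \<epsilon> powr H))"
  proof (rule l2_bounded_limit[OF _ tendsto_const V])
    show "AE \<omega> in M. (\<lambda>m. c * L m \<omega>) \<longlonglongrightarrow> V \<omega>"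
      using conv by eventually_elim blast
  qed
  then show ?thesis by (simp add: mult_ac)
qed

text \<open>The integral \<open>U\<close> of \<open>y\<close> is differentiable although \<open>y\<close> need not be, so the integrating factor is
applied to \<open>U\<close>. Writing the result with \<open>b t - b s\<close> rather than \<open>b s - b 0\<close> makes the small increments at recent times
meet the large values of the kernel.\<close>
lemma ou_variation_of_constants:
  fixes y b :: "real \<Rightarrow> real"
  assumes \<epsilon>: "0 < \<epsilon>" and t: "0 \<le> t"
    and y: "continuous_on {0..} y"
    and eq: "\<And>s. 0 \<le> s \<Longrightarrow> y s = y 0 - 1 / \<epsilon> * integral {0..s} y + \<kappa> * (b s - b 0)"
  shows "y t = exp (- t / \<epsilon>) * (y 0 + \<kappa> * (b t - b 0)) +
    integral {0..t} (\<lambda>s. \<kappa> / \<epsilon> * exp (- (t - s) / \<epsilon>) * (b t - b s))"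
proof -
  define U where "U s = integral {0..s} y" for s
  have yt: "continuous_on {0..t} y" by (rule continuous_on_subset[OF y]) auto
  have "((\<lambda>s. exp (s / \<epsilon>) * (y 0 + \<kappa> * (b s - b 0))) has_integral
      exp (t / \<epsilon>) * U t - exp (0 / \<epsilon>) * U 0) {0..t}"
  proof (rule fundamental_theorem_of_calculus[OF t])
    fix s assume s: "s \<in> {0..t}"
    have U': "(U has_real_derivative y s) (at s within {0..t})"
      unfolding U_def has_real_derivative_iff_has_vector_derivative
      by (rule integral_has_vector_derivative[OF yt s])
    have exp': "((\<lambda>s. exp (s / \<epsilon>)) has_real_derivative exp (s / \<epsilon>) * (1 / \<epsilon>)) (at s within {0..t})"
      using \<epsilon> by (auto intro!: derivative_eq_intros)
    have "((\<lambda>s. exp (s / \<epsilon>) * U s) has_real_derivative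
        exp (s / \<epsilon>) * (U s / \<epsilon> + y s)) (at s within {0..t})"
      by (rule DERIV_cong[OF DERIV_mult[OF exp' U']]) (simp add: algebra_simps)
    moreover have "U s / \<epsilon> + y s = y 0 + \<kappa> * (b s - b 0)"
      using eq[of s] s by (simp add: U_def)
    ultimately show "((\<lambda>s. exp (s / \<epsilon>) * U s) has_vector_derivative
        exp (s / \<epsilon>) * (y 0 + \<kappa> * (b s - b 0))) (at s within {0..t})"
      by (simp add: has_real_derivative_iff_has_vector_derivative)
  qed
  then have U1: "((\<lambda>s. exp (s / \<epsilon>) * (y 0 + \<kappa> * (b s - b 0))) has_integral exp (t / \<epsilon>) * U t) {0..t}"
    by (simp add: U_def)
  have "((\<lambda>s. exp (s / \<epsilon>) / \<epsilon>) has_integral exp (t / \<epsilon>) - exp (0 / \<epsilon>)) {0..t}"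
    using \<epsilon> by (intro fundamental_theorem_of_calculus[OF t])
      (auto simp: has_real_derivative_iff_has_vector_derivative[symmetric] intro!: derivative_eq_intros)
  then have E: "((\<lambda>s. exp (s / \<epsilon>) / \<epsilon>) has_integral exp (t / \<epsilon>) - 1) {0..t}" by simp
  have "((\<lambda>s. (exp (s / \<epsilon>) / \<epsilon>) * (y 0 + \<kappa> * (b t - b 0)) - 1 / \<epsilon> * (exp (s / \<epsilon>) * (y 0 + \<kappa> * (b s - b 0))))
      has_integral (exp (t / \<epsilon>) - 1) * (y 0 + \<kappa> * (b t - b 0)) - 1 / \<epsilon> * (exp (t / \<epsilon>) * U t)) {0..t}"
    by (intro has_integral_diff has_integral_mult_left[OF E] has_integral_mult_right[OF U1])
  from has_integral_mult_right[OF this, of "exp (- t / \<epsilon>)"]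
  have "((\<lambda>s. \<kappa> / \<epsilon> * exp (- (t - s) / \<epsilon>) * (b t - b s)) has_integral
      (1 - exp (- t / \<epsilon>)) * (y 0 + \<kappa> * (b t - b 0)) - 1 / \<epsilon> * U t) {0..t}"
  proof (rule has_integral_eq_rhs[OF has_integral_eq, rotated])
    have inv: "exp (- t / \<epsilon>) * exp (t / \<epsilon>) = 1" by (simp add: exp_add[symmetric])
    have "e * ((f - 1) * A - 1 / \<epsilon> * (f * u)) = (1 - e) * A - 1 / \<epsilon> * u" if "e * f = 1" for e f A u :: real
    proof -
      have "e * ((f - 1) * A - 1 / \<epsilon> * (f * u)) = (e * f) * A - e * A - 1 / \<epsilon> * ((e * f) * u)"
        by (simp add: algebra_simps)
      then show ?thesis unfolding that by (simp add: algebra_simps)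
    qed
    from this[OF inv, symmetric] show "(1 - exp (- t / \<epsilon>)) * (y 0 + \<kappa> * (b t - b 0)) - 1 / \<epsilon> * U t =
        exp (- t / \<epsilon>) * ((exp (t / \<epsilon>) - 1) * (y 0 + \<kappa> * (b t - b 0)) - 1 / \<epsilon> * (exp (t / \<epsilon>) * U t))" .
  next
    fix s
    have exps: "exp (- (t - s) / \<epsilon>) = exp (- t / \<epsilon>) * exp (s / \<epsilon>)"
      by (simp add: exp_add[symmetric] diff_divide_distrib)
    have alg: "a * (e / \<epsilon> * (A + \<kappa> * (x - w)) - 1 / \<epsilon> * (e * (A + \<kappa> * (z - w)))) = \<kappa> / \<epsilon> * (a * e) * (x - z)"
      for a e A w x z :: real
      using \<epsilon> by (simp add: field_simps)
    show "exp (- t / \<epsilon>) * (exp (s / \<epsilon>) / \<epsilon> * (y 0 + \<kappa> * (b t - b 0)) -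
        1 / \<epsilon> * (exp (s / \<epsilon>) * (y 0 + \<kappa> * (b s - b 0)))) = \<kappa> / \<epsilon> * exp (- (t - s) / \<epsilon>) * (b t - b s)"
      unfolding exps by (rule alg)
  qed
  then have "integral {0..t} (\<lambda>s. \<kappa> / \<epsilon> * exp (- (t - s) / \<epsilon>) * (b t - b s)) =
      (1 - exp (- t / \<epsilon>)) * (y 0 + \<kappa> * (b t - b 0)) - 1 / \<epsilon> * U t"
    by (rule integral_unique)
  moreover have "y t = y 0 + \<kappa> * (b t - b 0) - 1 / \<epsilon> * U t"
    using eq[OF t] unfolding U_def by linarith
  moreover have "A - u = e * A + ((1 - e) * A - u)" for e A u :: real
    by (simp add: algebra_simps)
  ultimately show ?thesis by (simp only:)
qed

text \<open>The variation of constants formula has three terms: the decaying initial value, the decaying increment since time 0 and the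
integral over the past. They are bounded by 6, 2 and 4 times \<open>\<bar>\<sigma>\<^sub>2\<bar>\<close>. The scale \<open>\<epsilon> powr H\<close> of the noise
over the relaxation time \<open>\<epsilon>\<close> cancels the factor \<open>\<epsilon> powr (- H)\<close> in front of it.\<close>
lemma ou_l2_bound:
  assumes fbm: "\<And>s t. l2_bounded M (\<lambda>\<omega>. B t \<omega> - B s \<omega>) (\<bar>t - s\<bar> powr H)"
    and contB: "AE \<omega> in M. continuous_on UNIV (\<lambda>t. B t \<omega>)"
    and H: "0 < H" "H < 1" and \<epsilon>: "0 < \<epsilon>"
    and kin: "kinetic_fbm M H B \<sigma>\<^sub>1 \<sigma>\<^sub>2 x\<^sub>0 \<epsilon> X Y" and t: "0 \<le> t"
  shows "l2_bounded M (Y t) (12 * \<bar>\<sigma>\<^sub>2\<bar>)"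
proof -
  define \<kappa> where "\<kappa> = \<sigma>\<^sub>2 / \<epsilon> powr H"
  have \<kappa>\<epsilon>: "\<bar>\<kappa>\<bar> * \<epsilon> powr H = \<bar>\<sigma>\<^sub>2\<bar>" using \<epsilon> by (simp add: \<kappa>_def abs_divide)
  have Y_meas: "Y s \<in> borel_measurable M" if "0 \<le> s" for s
    using kin that by (simp add: kinetic_fbm_def)
  have path: "AE \<omega> in M. continuous_on {0..} (\<lambda>t. Y t \<omega>) \<and>
      (\<forall>t\<ge>0. Y t \<omega> = Y 0 \<omega> - (1 / \<epsilon>) * integral {0..t} (\<lambda>s. Y s \<omega>) + \<kappa> * (B t \<omega> - B 0 \<omega>))"
    using kin by (auto simp: kinetic_fbm_def \<kappa>_def elim!: eventually_mono)
  have "AE \<omega> in M. \<exists>I. has_improper_rs_integral (\<lambda>s. exp (s / \<epsilon>)) (\<lambda>s. B s \<omega>) 0 I \<and>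
      Y 0 \<omega> = \<epsilon> powr (- H) * \<sigma>\<^sub>2 * I"
    using kin by (auto simp: kinetic_fbm_def elim!: eventually_mono)
  from stationary_integral_l2[OF fbm \<epsilon> H Y_meas[OF order_refl] this]
  have "l2_bounded M (Y 0) (6 * \<bar>\<epsilon> powr (- H) * \<sigma>\<^sub>2\<bar> * \<epsilon> powr H)" .
  then have Y0: "l2_bounded M (Y 0) (6 * \<bar>\<sigma>\<^sub>2\<bar>)"
    using \<epsilon> by (simp add: abs_mult powr_minus field_simps)
  \<comment> \<open>\<open>N\<close> collects the two terms of the formula that do not involve an integral over the past.\<close>
  define N where "N \<omega> = exp (- t / \<epsilon>) * Y 0 \<omega> + (exp (- t / \<epsilon>) * \<kappa>) * (B t \<omega> - B 0 \<omega>)" for \<omega>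
  have decay: "exp (- u / \<epsilon>) * u powr H \<le> 2 * \<epsilon> powr H * exp (- u / (2 * \<epsilon>))" if "0 \<le> u" for u
  proof -
    have "exp (- u / \<epsilon>) * u powr H \<le> exp (- u / \<epsilon>) * (2 * \<epsilon> powr H * exp (u / (2 * \<epsilon>)))"
      using powr_le_scaled_exp[OF \<epsilon> that H] by (intro mult_left_mono) auto
    also have "\<dots> = 2 * \<epsilon> powr H * exp (- u / \<epsilon> + u / (2 * \<epsilon>))" by (simp only: exp_add mult_ac)
    also have "- u / \<epsilon> + u / (2 * \<epsilon>) = - u / (2 * \<epsilon>)" using \<epsilon> by (simp add: field_simps)
    finally show ?thesis .
  qed
  have "l2_bounded M N (\<bar>exp (- t / \<epsilon>)\<bar> * (6 * \<bar>\<sigma>\<^sub>2\<bar>) + \<bar>exp (- t / \<epsilon>) * \<kappa>\<bar> * \<bar>t - 0\<bar> powr H)"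
    unfolding N_def by (intro l2_bounded_add l2_bounded_cmult Y0 fbm)
  moreover have "\<bar>exp (- t / \<epsilon>)\<bar> * (6 * \<bar>\<sigma>\<^sub>2\<bar>) + \<bar>exp (- t / \<epsilon>) * \<kappa>\<bar> * \<bar>t - 0\<bar> powr H \<le> 8 * \<bar>\<sigma>\<^sub>2\<bar>"
  proof -
    have "\<bar>exp (- t / \<epsilon>)\<bar> * (6 * \<bar>\<sigma>\<^sub>2\<bar>) \<le> 1 * (6 * \<bar>\<sigma>\<^sub>2\<bar>)"
      using t \<epsilon> by (intro mult_right_mono) auto
    moreover have "\<bar>exp (- t / \<epsilon>) * \<kappa>\<bar> * \<bar>t - 0\<bar> powr H = \<bar>\<kappa>\<bar> * (exp (- t / \<epsilon>) * t powr H)"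
      using t by (simp add: abs_mult)
    moreover have "\<bar>\<kappa>\<bar> * (exp (- t / \<epsilon>) * t powr H) \<le> \<bar>\<kappa>\<bar> * (2 * \<epsilon> powr H * 1)"
      using t \<epsilon> by (intro mult_left_mono order_trans[OF decay]) auto
    moreover have "\<bar>\<kappa>\<bar> * (2 * \<epsilon> powr H * 1) = 2 * \<bar>\<sigma>\<^sub>2\<bar>" using \<kappa>\<epsilon> by simp
    ultimately show ?thesis by linarith
  qed
  ultimately have N: "l2_bounded M N (8 * \<bar>\<sigma>\<^sub>2\<bar>)" by (rule l2_bounded_mono)
  define \<phi> where "\<phi> s = 2 * \<bar>\<sigma>\<^sub>2\<bar> / \<epsilon> * exp (- (t - s) / (2 * \<epsilon>))" for s
  have R: "l2_bounded M (\<lambda>\<omega>. Y t \<omega> + (- 1) * N \<omega>) (integral {0..t} \<phi>)"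
  proof (rule l2_bounded_integral[OF t, where Z = "\<lambda>s \<omega>. \<kappa> / \<epsilon> * exp (- (t - s) / \<epsilon>) * (B t \<omega> - B s \<omega>)"])
    fix s assume s: "s \<in> {0..t}"
    have "l2_bounded M (\<lambda>\<omega>. \<kappa> / \<epsilon> * exp (- (t - s) / \<epsilon>) * (B t \<omega> - B s \<omega>))
        (\<bar>\<kappa> / \<epsilon> * exp (- (t - s) / \<epsilon>)\<bar> * \<bar>t - s\<bar> powr H)"
      by (intro l2_bounded_cmult fbm)
    moreover have "\<bar>\<kappa> / \<epsilon> * exp (- (t - s) / \<epsilon>)\<bar> * \<bar>t - s\<bar> powr H \<le> \<phi> s"
    proof -
      have "\<bar>\<kappa> / \<epsilon> * exp (- (t - s) / \<epsilon>)\<bar> * \<bar>t - s\<bar> powr H =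
          \<bar>\<kappa>\<bar> / \<epsilon> * (exp (- (t - s) / \<epsilon>) * (t - s) powr H)"
        using s \<epsilon> by (simp add: abs_mult)
      also have "\<dots> \<le> \<bar>\<kappa>\<bar> / \<epsilon> * (2 * \<epsilon> powr H * exp (- (t - s) / (2 * \<epsilon>)))"
        using s \<epsilon> by (intro mult_left_mono decay) auto
      also have "\<dots> = 2 * (\<bar>\<kappa>\<bar> * \<epsilon> powr H) / \<epsilon> * exp (- (t - s) / (2 * \<epsilon>))" by simp
      finally show ?thesis by (simp only: \<kappa>\<epsilon> \<phi>_def)
    qed
    ultimately show "l2_bounded M (\<lambda>\<omega>. \<kappa> / \<epsilon> * exp (- (t - s) / \<epsilon>) * (B t \<omega> - B s \<omega>)) (\<phi> s)"
      by (rule l2_bounded_mono)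
  next
    show "AE \<omega> in M. continuous_on {0..t} (\<lambda>s. \<kappa> / \<epsilon> * exp (- (t - s) / \<epsilon>) * (B t \<omega> - B s \<omega>))"
      using contB
      by eventually_elim (use \<epsilon> in \<open>auto intro!: continuous_intros elim: continuous_on_subset\<close>)
    show "continuous_on {0..t} \<phi>" unfolding \<phi>_def using \<epsilon> by (auto intro!: continuous_intros)
    show "(\<lambda>\<omega>. Y t \<omega> + - 1 * N \<omega>) \<in> borel_measurable M"
      using Y_meas[OF t] l2_boundedD(1)[OF N] by measurable
    show "AE \<omega> in M. Y t \<omega> + - 1 * N \<omega> =
        integral {0..t} (\<lambda>s. \<kappa> / \<epsilon> * exp (- (t - s) / \<epsilon>) * (B t \<omega> - B s \<omega>))"
      using path contB
    proof eventually_elim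
      case (elim \<omega>)
      then have "Y t \<omega> = exp (- t / \<epsilon>) * (Y 0 \<omega> + \<kappa> * (B t \<omega> - B 0 \<omega>)) +
          integral {0..t} (\<lambda>s. \<kappa> / \<epsilon> * exp (- (t - s) / \<epsilon>) * (B t \<omega> - B s \<omega>))"
        by (intro ou_variation_of_constants[OF \<epsilon> t, where y = "\<lambda>t. Y t \<omega>" and b = "\<lambda>t. B t \<omega>"]; blast)
      then show ?case by (simp add: N_def algebra_simps)
    qed
  qed
  have "(\<phi> has_integral 4 * \<bar>\<sigma>\<^sub>2\<bar> * exp (- (t - t) / (2 * \<epsilon>)) - 4 * \<bar>\<sigma>\<^sub>2\<bar> * exp (- (t - 0) / (2 * \<epsilon>))) {0..t}"
    unfolding \<phi>_def using \<epsilon>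
    by (intro fundamental_theorem_of_calculus t)
      (auto simp: has_real_derivative_iff_has_vector_derivative[symmetric] intro!: derivative_eq_intros)
  then have "integral {0..t} \<phi> = 4 * \<bar>\<sigma>\<^sub>2\<bar> * exp (- (t - t) / (2 * \<epsilon>)) - 4 * \<bar>\<sigma>\<^sub>2\<bar> * exp (- (t - 0) / (2 * \<epsilon>))"
    by (rule integral_unique)
  also have "\<dots> \<le> 4 * \<bar>\<sigma>\<^sub>2\<bar>" by simp
  finally have "l2_bounded M (\<lambda>\<omega>. Y t \<omega> + (- 1) * N \<omega>) (4 * \<bar>\<sigma>\<^sub>2\<bar>)"
    by (rule l2_bounded_mono[OF R])
  from l2_bounded_add[OF this N] show ?thesis by simp
qed

lemma kinetic_increment_l2:
  assumes fbm: "\<And>s t. l2_bounded M (\<lambda>\<omega>. B t \<omega> - B s \<omega>) (\<bar>t - s\<bar> powr H)"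
    and contB: "AE \<omega> in M. continuous_on UNIV (\<lambda>t. B t \<omega>)"
    and H: "0 < H" "H < 1" and \<epsilon>: "0 < \<epsilon>"
    and kin: "kinetic_fbm M H B \<sigma>\<^sub>1 \<sigma>\<^sub>2 x\<^sub>0 \<epsilon> X Y" and st: "0 \<le> s" "s \<le> t"
  shows "l2_bounded M (\<lambda>\<omega>. X t \<omega> - X s \<omega>) (12 * \<bar>\<sigma>\<^sub>1 * \<sigma>\<^sub>2\<bar> * \<epsilon> powr (H - 1) * (t - s))"
proof -
  have [measurable]: "X u \<in> borel_measurable M" if "0 \<le> u" for u
    using kin that by (simp add: kinetic_fbm_def)
  have t: "0 \<le> t" using st by simp
  define c where "c = \<sigma>\<^sub>1 * \<epsilon> powr (H - 1)"
  have "l2_bounded M (\<lambda>\<omega>. X t \<omega> - X s \<omega>) (integral {s..t} (\<lambda>_. \<bar>c\<bar> * (12 * \<bar>\<sigma>\<^sub>2\<bar>)))"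
  proof (rule l2_bounded_integral[OF st(2), where Z = "\<lambda>r \<omega>. c * Y r \<omega>"])
    show "l2_bounded M (\<lambda>\<omega>. c * Y r \<omega>) (\<bar>c\<bar> * (12 * \<bar>\<sigma>\<^sub>2\<bar>))" if "r \<in> {s..t}" for r
      using that st by (intro l2_bounded_cmult ou_l2_bound[OF fbm contB H \<epsilon> kin]) auto
    show "(\<lambda>\<omega>. X t \<omega> - X s \<omega>) \<in> borel_measurable M" using st t by measurable
    have path: "AE \<omega> in M. continuous_on {0..} (\<lambda>t. Y t \<omega>) \<and>
        (\<forall>t\<ge>0. X t \<omega> = x\<^sub>0 + integral {0..t} (\<lambda>s. c * Y s \<omega>))"
      using kin by (auto simp: kinetic_fbm_def c_def elim!: eventually_mono)
    then show "AE \<omega> in M. continuous_on {s..t} (\<lambda>r. c * Y r \<omega>)"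
      by eventually_elim (use st in \<open>auto intro!: continuous_intros elim: continuous_on_subset\<close>)
    show "AE \<omega> in M. X t \<omega> - X s \<omega> = integral {s..t} (\<lambda>r. c * Y r \<omega>)"
      using path
    proof eventually_elim
      case (elim \<omega>)
      have "(\<lambda>r. c * Y r \<omega>) integrable_on {0..t}"
        by (intro integrable_continuous_interval continuous_on_mult_left continuous_on_subset[OF conjunct1[OF elim]]) auto
      from Henstock_Kurzweil_Integration.integral_combine[OF st this]
      show ?case using elim st t by simp
    qed
  qed auto
  also have "integral {s..t} (\<lambda>_. \<bar>c\<bar> * (12 * \<bar>\<sigma>\<^sub>2\<bar>)) = 12 * \<bar>\<sigma>\<^sub>1 * \<sigma>\<^sub>2\<bar> * \<epsilon> powr (H - 1) * (t - s)"
    using st by (simp add: c_def abs_mult)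
  finally show ?thesis .
qed

lemma sigma2_hat_expectation_le:
  assumes H: "0 < H" "H < 1" and \<delta>: "0 < \<delta>" and N: "0 < N"
    and X: "\<And>t. 0 \<le> t \<Longrightarrow> X t \<in> borel_measurable M"
    and inc: "\<And>i. i < N \<Longrightarrow>
      l2_bounded M (\<lambda>\<omega>. X ((real i + 1) * \<delta>) \<omega> - X (real i * \<delta>) \<omega>) (C * \<delta>)"
  shows "integrable M (\<lambda>\<omega>. sigma2_hat H \<delta> N (\<lambda>t. X t \<omega>))"
    and "(\<integral>\<omega>. sigma2_hat H \<delta> N (\<lambda>t. X t \<omega>) \<partial>M) \<le> C\<^sup>2 * (\<delta>\<^sup>2 / (\<delta> powr (2 * H) * fgn_eigenvalue_bound H N))"
proof -
  define c where "c = \<delta> powr (2 * H) * fgn_eigenvalue_bound H N"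
  have c: "0 < c" using fgn_eigenvalue_bound_pos[OF H N] \<delta> by (simp add: c_def)
  define S where "S \<omega> = (\<Sum>i<N. (X ((real i + 1) * \<delta>) \<omega> - X (real i * \<delta>) \<omega>)\<^sup>2) / (real N * c)" for \<omega>
  have S_int: "integrable M S"
    unfolding S_def
    by (intro integrable_divide_zero Bochner_Integration.integrable_sum impI l2_bounded_integrable(1)[OF inc]) auto
  have le: "sigma2_hat H \<delta> N (\<lambda>t. X t \<omega>) \<le> S \<omega>" for \<omega>
    unfolding S_def c_def by (rule sigma2_hat_bounds(2)[OF H \<delta> N])
  have nonneg: "0 \<le> sigma2_hat H \<delta> N (\<lambda>t. X t \<omega>)" for \<omega>
    by (rule sigma2_hat_bounds(1)[OF H \<delta> N])
  show int: "integrable M (\<lambda>\<omega>. sigma2_hat H \<delta> N (\<lambda>t. X t \<omega>))"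
  proof (rule Bochner_Integration.integrable_bound[OF S_int sigma2_hat_measurable[OF H \<delta> N X]])
    show "AE \<omega> in M. norm (sigma2_hat H \<delta> N (\<lambda>t. X t \<omega>)) \<le> norm (S \<omega>)"
      using le nonneg order_trans[OF nonneg le] by (intro AE_I2) simp
  qed
  have "(\<integral>\<omega>. sigma2_hat H \<delta> N (\<lambda>t. X t \<omega>) \<partial>M) \<le> (\<integral>\<omega>. S \<omega> \<partial>M)"
    by (rule integral_mono[OF int S_int le])
  also have "\<dots> = (\<Sum>i<N. \<integral>\<omega>. (X ((real i + 1) * \<delta>) \<omega> - X (real i * \<delta>) \<omega>)\<^sup>2 \<partial>M) / (real N * c)"
    unfolding S_def using l2_bounded_integrable(1)[OF inc]
    by (subst integral_divide_zero) (simp add: Bochner_Integration.integral_sum)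
  also have "\<dots> \<le> (\<Sum>i<N. (C * \<delta>)\<^sup>2) / (real N * c)"
    using c l2_bounded_integrable(2)[OF inc] by (intro divide_right_mono sum_mono) auto
  also have "\<dots> = C\<^sup>2 * (\<delta>\<^sup>2 / c)" using N by (simp add: power_mult_distrib)
  finally show "(\<integral>\<omega>. sigma2_hat H \<delta> N (\<lambda>t. X t \<omega>) \<partial>M) \<le> C\<^sup>2 * (\<delta>\<^sup>2 / (\<delta> powr (2 * H) * fgn_eigenvalue_bound H N))"
    by (simp add: c_def)
qed

section \<open>The two limits\<close>

lemma kinetic_paths_lipschitz:
  assumes kin: "kinetic_fbm M H B \<sigma>\<^sub>1 \<sigma>\<^sub>2 x\<^sub>0 \<epsilon> X Y"
  shows "AE \<omega> in M. \<exists>C. \<forall>s t. 0 \<le> s \<longrightarrow> s \<le> t \<longrightarrow> t \<le> T \<longrightarrow> \<bar>X t \<omega> - X s \<omega>\<bar> \<le> C * (t - s)"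
proof -
  define c where "c = \<sigma>\<^sub>1 * \<epsilon> powr (H - 1)"
  have "AE \<omega> in M. continuous_on {0..} (\<lambda>t. Y t \<omega>) \<and>
      (\<forall>t\<ge>0. X t \<omega> = x\<^sub>0 + integral {0..t} (\<lambda>s. c * Y s \<omega>))"
    using kin by (auto simp: kinetic_fbm_def c_def elim!: eventually_mono)
  then show ?thesis
  proof eventually_elim
    case (elim \<omega>)
    let ?y = "\<lambda>s. c * Y s \<omega>"
    have cont: "continuous_on {0..} ?y" using elim by (auto intro!: continuous_intros)
    then have "compact (?y ` {0..T})"
      by (intro compact_continuous_image continuous_on_subset[OF cont]) auto
    then have "bounded (?y ` {0..T})" by (rule compact_imp_bounded)
    then obtain C where C: "\<And>s. s \<in> {0..T} \<Longrightarrow> \<bar>?y s\<bar> \<le> C"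
      unfolding bounded_iff by (metis imageI real_norm_def)
    have "\<bar>X t \<omega> - X s \<omega>\<bar> \<le> C * (t - s)" if st: "0 \<le> s" "s \<le> t" "t \<le> T" for s t
    proof -
      have "?y integrable_on {0..t}"
        by (intro integrable_continuous_interval continuous_on_subset[OF cont]) auto
      from Henstock_Kurzweil_Integration.integral_combine[OF st(1,2) this]
      have "X t \<omega> - X s \<omega> = integral {s..t} ?y" using elim st by simp
      moreover have "norm (integral {s..t} ?y) \<le> C * (t - s)"
        using st C by (intro integral_bound continuous_on_subset[OF cont]) auto
      ultimately show ?thesis by simp
    qed
    then show ?case by blast
  qed
qed

theorem theorem3p1:
  fixes M :: "'a measure" and B :: "real \<Rightarrow> 'a \<Rightarrow> real"
    and X Y :: "real \<Rightarrow> real \<Rightarrow> 'a \<Rightarrow> real"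
    and H T \<sigma>\<^sub>1 \<sigma>\<^sub>2 x\<^sub>0 :: real
  assumes "prob_space M"
    and "0 < H" and "H < 1" and "0 < T"
    and "fractional_brownian_motion M H B"
    and "\<And>\<epsilon>. 0 < \<epsilon> \<Longrightarrow> kinetic_fbm M H B \<sigma>\<^sub>1 \<sigma>\<^sub>2 x\<^sub>0 \<epsilon> (X \<epsilon>) (Y \<epsilon>)"
  shows "(\<forall>\<epsilon>>0. AE \<omega> in M.
            (\<lambda>N. sigma2_hat H (T / real N) N (\<lambda>t. X \<epsilon> t \<omega>)) \<longlonglongrightarrow> 0)
       \<and> (\<forall>\<alpha>>0. \<alpha> > max 1 (2 * (1 - H)) \<longrightarrow>
            (let E = {\<epsilon>. 0 < \<epsilon> \<and> (\<exists>N::nat. 0 < N \<and> T / \<epsilon> powr \<alpha> = real N)};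
                 est = (\<lambda>\<epsilon> \<omega>. sigma2_hat H (\<epsilon> powr \<alpha>) (nat \<lfloor>T / \<epsilon> powr \<alpha>\<rfloor>) (\<lambda>t. X \<epsilon> t \<omega>))
             in (\<forall>\<epsilon>\<in>E. integrable M (est \<epsilon>)) \<and>
                ((\<lambda>\<epsilon>. \<integral>\<omega>. est \<epsilon> \<omega> \<partial>M) \<longlongrightarrow> 0) (at 0 within E)))"
proof (intro conjI allI impI)
  interpret prob_space M by fact
  note H = \<open>0 < H\<close> \<open>H < 1\<close> and T = \<open>0 < T\<close> and kin = assms(6)
  note fbm = fbm_increment_l2[OF assms(5)]
  have contB: "AE \<omega> in M. continuous_on UNIV (\<lambda>t. B t \<omega>)"
    using assms(5) by (simp add: fractional_brownian_motion_def)
  {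
    fix \<epsilon> :: real assume "0 < \<epsilon>"
    from kinetic_paths_lipschitz[OF kin[OF this], of T]
    show "AE \<omega> in M. (\<lambda>N. sigma2_hat H (T / real N) N (\<lambda>t. X \<epsilon> t \<omega>)) \<longlonglongrightarrow> 0"
    proof eventually_elim
      case (elim \<omega>)
      then obtain C where "\<And>s t. 0 \<le> s \<Longrightarrow> s \<le> t \<Longrightarrow> t \<le> T \<Longrightarrow> \<bar>X \<epsilon> t \<omega> - X \<epsilon> s \<omega>\<bar> \<le> C * (t - s)"
        by blast
      then show ?case by (rule sigma2_hat_tendsto_0[OF H T])
    qed
  }
  fix \<alpha> :: real assume "0 < \<alpha>" and \<alpha>: "max 1 (2 * (1 - H)) < \<alpha>"
  define E where "E = {\<epsilon>. 0 < \<epsilon> \<and> (\<exists>N::nat. 0 < N \<and> T / \<epsilon> powr \<alpha> = real N)}"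
  define est where "est = (\<lambda>\<epsilon> \<omega>. sigma2_hat H (\<epsilon> powr \<alpha>) (nat \<lfloor>T / \<epsilon> powr \<alpha>\<rfloor>) (\<lambda>t. X \<epsilon> t \<omega>))"
  define \<beta> where "\<beta> = min 1 (2 * (1 - H))"
  define \<gamma> where "\<gamma> = \<alpha> * \<beta> - 2 * (1 - H)"
  have "0 < \<gamma>"
  proof -
    have "2 * (1 - H) = max 1 (2 * (1 - H)) * \<beta>" by (simp add: \<beta>_def max_def min_def)
    also have "\<dots> < \<alpha> * \<beta>" using \<alpha> H by (intro mult_strict_right_mono) (auto simp: \<beta>_def)
    finally show ?thesis by (simp add: \<gamma>_def)
  qed
  obtain K where "0 < K" and K: "\<And>\<delta> N. 0 < \<delta> \<Longrightarrow> 0 < N \<Longrightarrow> real N * \<delta> = T \<Longrightarrow>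
      \<delta>\<^sup>2 / (\<delta> powr (2 * H) * fgn_eigenvalue_bound H N) = K * \<delta> powr \<beta>"
    using sigma2_hat_rate[OF H T] unfolding \<beta>_def by blast
  define D where "D = 12 * \<bar>\<sigma>\<^sub>1 * \<sigma>\<^sub>2\<bar>"
  have main: "integrable M (est \<epsilon>) \<and> 0 \<le> (\<integral>\<omega>. est \<epsilon> \<omega> \<partial>M) \<and> (\<integral>\<omega>. est \<epsilon> \<omega> \<partial>M) \<le> D\<^sup>2 * K * \<epsilon> powr \<gamma>"
    if "\<epsilon> \<in> E" for \<epsilon>
  proof -
    from that obtain N where \<epsilon>: "0 < \<epsilon>" and N: "0 < N" and TN: "T / \<epsilon> powr \<alpha> = real N"
      by (auto simp: E_def)
    define \<delta> where "\<delta> = \<epsilon> powr \<alpha>"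
    have \<delta>: "0 < \<delta>" using \<epsilon> by (simp add: \<delta>_def)
    have N\<delta>: "real N * \<delta> = T" unfolding TN[symmetric] using \<delta> by (simp add: \<delta>_def)
    have est: "est \<epsilon> = (\<lambda>\<omega>. sigma2_hat H \<delta> N (\<lambda>t. X \<epsilon> t \<omega>))"
      by (simp add: est_def TN \<delta>_def)
    have meas: "X \<epsilon> t \<in> borel_measurable M" if "0 \<le> t" for t
      using kin[OF \<epsilon>] that by (simp add: kinetic_fbm_def)
    have inc: "l2_bounded M (\<lambda>\<omega>. X \<epsilon> ((real i + 1) * \<delta>) \<omega> - X \<epsilon> (real i * \<delta>) \<omega>) (D * \<epsilon> powr (H - 1) * \<delta>)" for i
    proof -
      have "l2_bounded M (\<lambda>\<omega>. X \<epsilon> ((real i + 1) * \<delta>) \<omega> - X \<epsilon> (real i * \<delta>) \<omega>)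
          (D * \<epsilon> powr (H - 1) * ((real i + 1) * \<delta> - real i * \<delta>))"
        unfolding D_def using \<delta>
        by (intro kinetic_increment_l2[OF fbm contB H \<epsilon> kin[OF \<epsilon>]] mult_right_mono) auto
      then show ?thesis by (simp add: left_diff_distrib[symmetric])
    qed
    note bound = sigma2_hat_expectation_le[OF H \<delta> N meas inc]
    have "(D * \<epsilon> powr (H - 1))\<^sup>2 * (K * \<delta> powr \<beta>) =
        D\<^sup>2 * K * (\<epsilon> powr (H - 1) * \<epsilon> powr (H - 1) * (\<epsilon> powr \<alpha>) powr \<beta>)"
      by (simp add: \<delta>_def power2_eq_square)
    also have "\<epsilon> powr (H - 1) * \<epsilon> powr (H - 1) * (\<epsilon> powr \<alpha>) powr \<beta> = \<epsilon> powr \<gamma>"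
      unfolding powr_powr powr_add[symmetric] \<gamma>_def by (rule arg_cong[where f = "(powr) \<epsilon>"]) simp
    finally have rate: "(D * \<epsilon> powr (H - 1))\<^sup>2 * (K * \<delta> powr \<beta>) = D\<^sup>2 * K * \<epsilon> powr \<gamma>" .
    have "(\<integral>\<omega>. est \<epsilon> \<omega> \<partial>M) \<le> D\<^sup>2 * K * \<epsilon> powr \<gamma>"
      using bound(2) unfolding est K[OF \<delta> N N\<delta>] rate .
    moreover have "0 \<le> (\<integral>\<omega>. est \<epsilon> \<omega> \<partial>M)"
      unfolding est by (intro integral_nonneg_AE AE_I2 sigma2_hat_bounds(1)[OF H \<delta> N])
    ultimately show ?thesis using bound(1) by (simp add: est)
  qed
  have "((\<lambda>\<epsilon>. \<epsilon> powr \<gamma>) \<longlongrightarrow> 0) (at 0 within E)"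
    by (rule tendsto_zero_powrI[OF tendsto_ident_at tendsto_const _ \<open>0 < \<gamma>\<close>])
      (auto simp: eventually_at_filter E_def)
  then have lim: "((\<lambda>\<epsilon>. D\<^sup>2 * K * \<epsilon> powr \<gamma>) \<longlongrightarrow> 0) (at 0 within E)"
    by (rule tendsto_mult_right_zero)
  have "((\<lambda>\<epsilon>. \<integral>\<omega>. est \<epsilon> \<omega> \<partial>M) \<longlongrightarrow> 0) (at 0 within E)"
    by (rule tendsto_sandwich[OF _ _ tendsto_const lim]) (use main in \<open>auto simp: eventually_at_filter\<close>)
  with main show "let E = {\<epsilon>. 0 < \<epsilon> \<and> (\<exists>N::nat. 0 < N \<and> T / \<epsilon> powr \<alpha> = real N)};
                 est = (\<lambda>\<epsilon> \<omega>. sigma2_hat H (\<epsilon> powr \<alpha>) (nat \<lfloor>T / \<epsilon> powr \<alpha>\<rfloor>) (\<lambda>t. X \<epsilon> t \<omega>))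
             in (\<forall>\<epsilon>\<in>E. integrable M (est \<epsilon>)) \<and>
                ((\<lambda>\<epsilon>. \<integral>\<omega>. est \<epsilon> \<omega> \<partial>M) \<longlongrightarrow> 0) (at 0 within E)"
    unfolding Let_def E_def[symmetric] est_def[symmetric] by blast
qed

end
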